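(* Let $M\subset\mathbb{C}^n\times\mathbb{C}^d$ be a real-analytic generic submanifold through the origin given in normal coordinates $(z,w)\in\mathbb{C}^n\times\mathbb{C}^d$ near the origin. Suppose that $f$ and $g$ ($g\not\equiv 0$) are two holomorphic functions, defined near the origin, such that $|f|=|g|$ on $M$. Then $f/g$ depends only on $w$. In other words, if $h$ is a meromorphic function near the origin which is real valued on $M$, then $h$ depends only on $w$.
   Context: A real-analytic submanifold $M\subset\mathbb{C}^N$ is a CR submanifold if the space of vectors $\sum_j a_j\,\partial/\partial\bar z_j$ tangent to $M$ has constant complex dimension (the CR dimension); it is generic if it is moreover not (locally) contained in a proper complex analytic subvariety. A generic submanifold of real codimension $d$ and CR dimension $n$ through $0$ is given in normal coordinates $(z,w)\in\mathbb{C}^n\times\mathbb{C}^d$ if it is defined near $0$ by $w=Q(z,\bar z,\bar w)$ with $Q$ a holomorphic map near the origin of $\mathbb{C}^n\times\mathbb{C}^n\times\mathbb{C}^d$ satisfying $Q(0,\zeta,\omega)\equiv Q(z,0,\omega)\equiv\omega$ and $Q(z,\zeta,\bar Q(\zeta,z,w))\equiv w$. "Real valued on $M$" means at the points of $M$ where $h$ is defined. *)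

theory Defs
  imports "HOL-Analysis.Analysis"
begin

section \<open>Functions of several variables\<close>

definition mv_holomorphic_on :: "(complex^'k::finite \<Rightarrow> complex) \<Rightarrow> (complex^'k) set \<Rightarrow> bool" where
  "mv_holomorphic_on f U \<longleftrightarrow>
     open U \<and>
     (\<forall>p\<in>U. \<exists>L. (f has_derivative L) (at p) \<and> (\<forall>c v. L (c *s v) = c * L v))"

definition mv_holomorphic_at :: "(complex^'k::finite \<Rightarrow> complex) \<Rightarrow> complex^'k \<Rightarrow> bool" where
  "mv_holomorphic_at f p \<longleftrightarrow> (\<exists>U. p \<in> U \<and> mv_holomorphic_on f U)"

text \<open>
  Meromorphic functions are represented by total functions that are locally quotients of
  holomorphic functions off the zero set of the denominator; the values elsewhere are
  unconstrained. The points at which \<open>h\<close> is defined are those satisfying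
  \<^term>\<open>mv_holomorphic_at h\<close>, so an arbitrary value at a pole or a point of
  indeterminacy never counts as a value of the meromorphic function.
\<close>

definition mv_meromorphic_on :: "(complex^'k::finite \<Rightarrow> complex) \<Rightarrow> (complex^'k) set \<Rightarrow> bool" where
  "mv_meromorphic_on h U \<longleftrightarrow>
     open U \<and>
     (\<forall>p\<in>U. \<exists>W f g. open W \<and> connected W \<and> p \<in> W \<and> W \<subseteq> U \<and>
        mv_holomorphic_on f W \<and> mv_holomorphic_on g W \<and> (\<exists>q\<in>W. g q \<noteq> 0) \<and>
        (\<forall>q\<in>W. g q \<noteq> 0 \<longrightarrow> h q = f q / g q))"

text \<open>
  Local expansion in an absolutely convergent power series; a multi-index is a function
  \<open>\<alpha>\<close> supported on \<^term>\<open>Basis\<close>.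
\<close>

definition real_analytic_on :: "('a::euclidean_space \<Rightarrow> real) \<Rightarrow> 'a set \<Rightarrow> bool" where
  "real_analytic_on r U \<longleftrightarrow>
     open U \<and>
     (\<forall>p\<in>U. \<exists>c :: ('a \<Rightarrow> nat) \<Rightarrow> real. \<exists>\<epsilon>>0. \<forall>x\<in>ball p \<epsilon>.
        ((\<lambda>\<alpha>. c \<alpha> * (\<Prod>b\<in>Basis. ((x - p) \<bullet> b) ^ \<alpha> b)) has_sum r x)
          {\<alpha>. \<forall>b. b \<notin> Basis \<longrightarrow> \<alpha> b = 0})"

section \<open>Generic submanifolds\<close>

definition real_analytic_submanifold :: "nat \<Rightarrow> 'a::euclidean_space set \<Rightarrow> bool" where
  "real_analytic_submanifold codim M \<longleftrightarrow>
     (\<forall>p\<in>M. \<exists>U (\<rho> :: nat \<Rightarrow> 'a \<Rightarrow> real).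
        open U \<and> p \<in> U \<and> (\<forall>i<codim. real_analytic_on (\<rho> i) U) \<and>
        M \<inter> U = {q\<in>U. \<forall>i<codim. \<rho> i q = 0} \<and>
        (\<forall>q\<in>M \<inter> U. \<forall>t :: nat \<Rightarrow> real.
           (\<forall>v. (\<Sum>i<codim. t i * frechet_derivative (\<rho> i) (at q) v) = 0) \<longrightarrow> (\<forall>i<codim. t i = 0)))"

text \<open>The Wirtinger derivative
  \<open>\<partial>r/\<partial>z\<^bsub>j\<^esub>\<^sup>* = (\<partial>r/\<partial>x\<^bsub>j\<^esub> + \<i> \<partial>r/\<partial>y\<^bsub>j\<^esub>) / 2\<close>
  with respect to the conjugate of the \<open>j\<close>-th coordinate.\<close>

definition dbar :: "(complex^'k::finite \<Rightarrow> real) \<Rightarrow> complex^'k \<Rightarrow> 'k \<Rightarrow> complex" where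
  "dbar r p j =
     (of_real (frechet_derivative r (at p) (axis j 1)) +
      \<i> * of_real (frechet_derivative r (at p) (axis j \<i>))) / 2"

text \<open>The coefficient vectors \<open>a\<close> of the (0,1)-vectors that are tangent to \<open>M\<close> at \<open>p\<close>, that is,
  annihilate every real-analytic function vanishing on \<open>M\<close> near \<open>p\<close>.\<close>

definition T01 :: "(complex^'k::finite) set \<Rightarrow> complex^'k \<Rightarrow> (complex^'k) set" where
  "T01 M p = {a. \<forall>r U. p \<in> U \<and> real_analytic_on r U \<and> (\<forall>q\<in>M \<inter> U. r q = 0) \<longrightarrow>
                   (\<Sum>j\<in>UNIV. a $ j * dbar r p j) = 0}"

definition CR_submanifold :: "nat \<Rightarrow> nat \<Rightarrow> (complex^'k::finite) set \<Rightarrow> bool" where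
  "CR_submanifold codim CRdim M \<longleftrightarrow>
     real_analytic_submanifold codim M \<and> (\<forall>p\<in>M. vec.dim (T01 M p) = CRdim)"

definition analytic_subvariety :: "(complex^'k::finite) set \<Rightarrow> (complex^'k) set \<Rightarrow> bool" where
  "analytic_subvariety U X \<longleftrightarrow>
     X \<subseteq> U \<and>
     (\<forall>p\<in>U. \<exists>W F. open W \<and> p \<in> W \<and> W \<subseteq> U \<and> finite F \<and> (\<forall>f\<in>F. mv_holomorphic_on f W) \<and>
        X \<inter> W = {q\<in>W. \<forall>f\<in>F. f q = 0})"

text \<open>Connectedness of \<open>U\<close> matters: a connected component of a disconnected \<open>U\<close> would be a
  proper subvariety of \<open>U\<close>.\<close>

definition generic_submanifold :: "nat \<Rightarrow> nat \<Rightarrow> (complex^'k::finite) set \<Rightarrow> bool" where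
  "generic_submanifold codim CRdim M \<longleftrightarrow>
     CR_submanifold codim CRdim M \<and>
     \<not> (\<exists>p\<in>M. \<exists>U X. open U \<and> connected U \<and> p \<in> U \<and>
           analytic_subvariety U X \<and> X \<noteq> U \<and> M \<inter> U \<subseteq> X)"

section \<open>Normal coordinates\<close>

text \<open>The space \<open>\<complex>\<^sup>n \<times> \<complex>\<^sup>d\<close> is \<^typ>\<open>complex^('n+'d)\<close>,
  with \<open>z\<close> the coordinates indexed by \<^const>\<open>Inl\<close> and \<open>w\<close> those indexed by \<^const>\<open>Inr\<close>.\<close>

definition zpart :: "complex^('n::finite+'d::finite) \<Rightarrow> complex^'n" where
  "zpart p = (\<chi> j. p $ Inl j)"

definition wpart :: "complex^('n::finite+'d::finite) \<Rightarrow> complex^'d" where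
  "wpart p = (\<chi> j. p $ Inr j)"

definition cnjv :: "complex^'k::finite \<Rightarrow> complex^'k" where
  "cnjv v = (\<chi> j. cnj (v $ j))"

definition holomorphic_map_near_0 ::
  "(complex^'n::finite \<Rightarrow> complex^'n \<Rightarrow> complex^'d::finite \<Rightarrow> complex^'d) \<Rightarrow> bool" where
  "holomorphic_map_near_0 Q \<longleftrightarrow>
     (\<exists>\<Omega> :: (complex^('n+('n+'d))) set. 0 \<in> \<Omega> \<and>
        (\<forall>j. mv_holomorphic_on (\<lambda>x. Q (zpart x) (zpart (wpart x)) (wpart (wpart x)) $ j) \<Omega>))"

definition Qbar ::
  "(complex^'n::finite \<Rightarrow> complex^'n \<Rightarrow> complex^'d::finite \<Rightarrow> complex^'d) \<Rightarrow>
   complex^'n \<Rightarrow> complex^'n \<Rightarrow> complex^'d \<Rightarrow> complex^'d" where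
  "Qbar Q \<zeta> z w = cnjv (Q (cnjv \<zeta>) (cnjv z) (cnjv w))"

definition normal_coordinates ::
  "(complex^('n::finite+'d::finite)) set \<Rightarrow>
   (complex^'n \<Rightarrow> complex^'n \<Rightarrow> complex^'d \<Rightarrow> complex^'d) \<Rightarrow> bool" where
  "normal_coordinates M Q \<longleftrightarrow>
     holomorphic_map_near_0 Q \<and>
     (\<forall>\<^sub>F (\<zeta>, \<omega>) in nhds (0, 0). Q 0 \<zeta> \<omega> = \<omega>) \<and>
     (\<forall>\<^sub>F (z, \<omega>) in nhds (0, 0). Q z 0 \<omega> = \<omega>) \<and>
     (\<forall>\<^sub>F (z, \<zeta>, w) in nhds (0, 0, 0). Q z \<zeta> (Qbar Q \<zeta> z w) = w) \<and>
     (\<forall>\<^sub>F p in nhds 0.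
        p \<in> M \<longleftrightarrow> wpart p = Q (zpart p) (cnjv (zpart p)) (cnjv (wpart p)))"

text \<open>Near the origin, \<open>h(z,w) = k(w)\<close> for some meromorphic \<open>k\<close>, at all points where \<open>h\<close> is defined.\<close>

definition depends_only_on_w :: "(complex^('n::finite+'d::finite) \<Rightarrow> complex) \<Rightarrow> bool" where
  "depends_only_on_w h \<longleftrightarrow>
     (\<exists>W V k. open W \<and> 0 \<in> W \<and> 0 \<in> V \<and> mv_meromorphic_on k V \<and>
        (\<forall>p\<in>W. wpart p \<in> V \<and> (mv_holomorphic_at h p \<longrightarrow> h p = k (wpart p))))"

end

theory Submission
  imports Defs "HOL-Complex_Analysis.Conformal_Mappings"
begin

text \<open>
  The idea is to complexify. Write \<open>F\<^sup>*\<close> for the holomorphic function obtained from \<open>F\<close> by conjugating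
  its values and its arguments. Both hypotheses, \<open>|f| = |g|\<close> on \<open>M\<close> and reality of \<open>h = f / g\<close> on \<open>M\<close>,
  have the form \<open>f \<cdot> cnj F = g \<cdot> cnj G\<close> on \<open>M\<close>, with \<open>(F, G) = (f, g)\<close> and \<open>(F, G) = (g, f)\<close>
  respectively. On \<open>M\<close>
  one has \<open>w = Q(z, \<zeta>, \<omega>)\<close> with \<open>\<zeta>\<close> and \<open>\<omega>\<close> the conjugates of \<open>z\<close> and \<open>w\<close>. Treating \<open>z\<close>, \<open>\<zeta>\<close>, \<open>\<omega>\<close> as
  independent variables gives
  \<open>f(z, Q(z, \<zeta>, \<omega>)) F\<^sup>*(\<zeta>, \<omega>) = g(z, Q(z, \<zeta>, \<omega>)) G\<^sup>*(\<zeta>, \<omega>)\<close> near the origin, because \<open>M\<close> is a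
  maximally totally real subset of its complexification (\<open>vanishing_on_complexification\<close>). To see
  this, \<open>M\<close> is described as the fixed set of an antiholomorphic involution, which becomes linear in
  the coordinate \<open>(\<omega> + Q(z, \<zeta>, \<omega>)) / 2\<close>; on the fixed space of an antilinear involution the uniqueness
  is a one-variable fact (\<open>vanishing_on_real_points\<close>).

  One would like to put \<open>\<zeta> = 0\<close>, where \<open>Q(z, 0, \<omega>) = \<omega>\<close>, and to solve for \<open>f / g\<close>; but \<open>F\<^sup>*\<close> and
  \<open>G\<^sup>*\<close> may both vanish identically there. So they are eliminated first: comparing two values \<open>z\<close>
  and \<open>z'\<close> with the same \<open>(\<zeta>, \<omega>)\<close> shows that the determinant of \<open>(f, g)\<close> at \<open>(z, Q(z, \<zeta>, \<omega>))\<close> and at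
  \<open>(z', Q(z', \<zeta>, \<omega>))\<close> vanishes for generic, hence for all \<open>(\<zeta>, \<omega>)\<close>. At \<open>\<zeta> = 0\<close> this reads
  \<open>f(z, w) g(z', w) = g(z, w) f(z', w)\<close> (\<open>quotient_independent_of_z\<close>), so \<open>f / g\<close> is the function
  \<open>f(z\<^sub>0, w) / g(z\<^sub>0, w)\<close> of \<open>w\<close> for a generic \<open>z\<^sub>0\<close> (\<open>depends_only_on_w_quotient\<close>).
\<close>

section \<open>Holomorphic functions and maps of several variables\<close>

lemma mv_holomorphic_on_subset:
  "mv_holomorphic_on f U \<Longrightarrow> open S \<Longrightarrow> S \<subseteq> U \<Longrightarrow> mv_holomorphic_on f S"
  unfolding mv_holomorphic_on_def by blast

lemma mv_holomorphic_on_imp_continuous_on: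
  "mv_holomorphic_on f U \<Longrightarrow> continuous_on U f"
  unfolding mv_holomorphic_on_def
  by (meson continuous_at_imp_continuous_on has_derivative_continuous)

lemma mv_holomorphic_on_diff:
  assumes "mv_holomorphic_on f U" "mv_holomorphic_on g U"
  shows "mv_holomorphic_on (\<lambda>x. f x - g x) U"
  unfolding mv_holomorphic_on_def
proof (intro conjI ballI)
  show "open U" using assms by (simp add: mv_holomorphic_on_def)
  fix p assume "p \<in> U"
  then obtain L L' where L: "(f has_derivative L) (at p)" "\<And>c v. L (c *s v) = c * L v"
    and L': "(g has_derivative L') (at p)" "\<And>c v. L' (c *s v) = c * L' v"
    using assms unfolding mv_holomorphic_on_def by metis
  show "\<exists>L. ((\<lambda>x. f x - g x) has_derivative L) (at p) \<and> (\<forall>c v. L (c *s v) = c * L v)"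
    by (rule exI[of _ "\<lambda>v. L v - L' v"])
      (auto intro!: has_derivative_diff L L' simp: L L' algebra_simps)
qed

lemma mv_holomorphic_on_mult:
  assumes "mv_holomorphic_on f U" "mv_holomorphic_on g U"
  shows "mv_holomorphic_on (\<lambda>x. f x * g x) U"
  unfolding mv_holomorphic_on_def
proof (intro conjI ballI)
  show "open U" using assms by (simp add: mv_holomorphic_on_def)
  fix p assume "p \<in> U"
  then obtain L L' where L: "(f has_derivative L) (at p)" "\<And>c v. L (c *s v) = c * L v"
    and L': "(g has_derivative L') (at p)" "\<And>c v. L' (c *s v) = c * L' v"
    using assms unfolding mv_holomorphic_on_def by metis
  show "\<exists>L. ((\<lambda>x. f x * g x) has_derivative L) (at p) \<and> (\<forall>c v. L (c *s v) = c * L v)"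
    by (rule exI[of _ "\<lambda>v. f p * L' v + L v * g p"])
      (auto intro!: has_derivative_mult L(1) L'(1) simp: L(2) L'(2) distrib_left mult.assoc mult.left_commute)
qed

lemma mv_holomorphic_on_divide:
  assumes "mv_holomorphic_on f U" "mv_holomorphic_on g U" "\<And>x. x \<in> U \<Longrightarrow> g x \<noteq> 0"
  shows "mv_holomorphic_on (\<lambda>x. f x / g x) U"
  unfolding mv_holomorphic_on_def
proof (intro conjI ballI)
  show "open U" using assms by (simp add: mv_holomorphic_on_def)
  fix p assume p: "p \<in> U"
  then obtain L L' where L: "(f has_derivative L) (at p)" "\<And>c v. L (c *s v) = c * L v"
    and L': "(g has_derivative L') (at p)" "\<And>c v. L' (c *s v) = c * L' v"
    using assms(1,2) unfolding mv_holomorphic_on_def by metis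
  show "\<exists>L. ((\<lambda>x. f x / g x) has_derivative L) (at p) \<and> (\<forall>c v. L (c *s v) = c * L v)"
    by (rule exI, rule conjI, rule has_derivative_divide'[OF L(1) L'(1) assms(3)[OF p]])
      (auto simp: L L' algebra_simps)
qed

lemma mv_holomorphic_on_transform:
  assumes "mv_holomorphic_on f U" "\<And>x. x \<in> U \<Longrightarrow> f x = g x"
  shows "mv_holomorphic_on g U"
  using assms unfolding mv_holomorphic_on_def
  by (metis has_derivative_transform_within_open)

definition holomorphic_map_on :: "(complex^'a::finite \<Rightarrow> complex^'b::finite) \<Rightarrow> (complex^'a) set \<Rightarrow> bool" where
  "holomorphic_map_on F S \<longleftrightarrow>
     open S \<and> (\<forall>p\<in>S. \<exists>L. (F has_derivative L) (at p) \<and> (\<forall>c v. L (c *s v) = c *s L v))"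

lemma has_derivative_vec_componentwise:
  fixes F :: "'a::real_normed_vector \<Rightarrow> complex^'b::finite"
  assumes "\<And>i. ((\<lambda>x. F x $ i) has_derivative (\<lambda>v. L v $ i)) (at p)"
  shows "(F has_derivative L) (at p)"
proof -
  have 1: "((\<lambda>x. inner (F x) (axis i u)) has_derivative (\<lambda>v. inner (L v) (axis i u))) (at p)" for i u
    using has_derivative_inner_left[OF assms[of i], of u] by (simp add: inner_axis)
  show ?thesis
    using 1 unfolding has_derivative_componentwise_within[of F L] Basis_vec_def by auto
qed

lemma holomorphic_map_on_componentwise:
  "holomorphic_map_on F S \<longleftrightarrow> open S \<and> (\<forall>i. mv_holomorphic_on (\<lambda>x. F x $ i) S)"
proof (intro iffI conjI allI)
  assume F: "holomorphic_map_on F S"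
  then show "open S" by (simp add: holomorphic_map_on_def)
  fix i
  show "mv_holomorphic_on (\<lambda>x. F x $ i) S"
    unfolding mv_holomorphic_on_def
  proof (intro conjI ballI)
    fix p assume "p \<in> S"
    then obtain L where L: "(F has_derivative L) (at p)" "\<And>c v. L (c *s v) = c *s L v"
      using F unfolding holomorphic_map_on_def by metis
    show "\<exists>L. ((\<lambda>x. F x $ i) has_derivative L) (at p) \<and> (\<forall>c v. L (c *s v) = c * L v)"
      by (rule exI[of _ "\<lambda>v. L v $ i"])
        (auto simp: L intro: bounded_linear.has_derivative[OF bounded_linear_vec_nth L(1)])
  qed fact
next
  assume R: "open S \<and> (\<forall>i. mv_holomorphic_on (\<lambda>x. F x $ i) S)"
  show "holomorphic_map_on F S"
    unfolding holomorphic_map_on_def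
  proof (intro conjI ballI)
    fix p assume "p \<in> S"
    then have "\<forall>i. \<exists>L. ((\<lambda>x. F x $ i) has_derivative L) (at p) \<and> (\<forall>c v. L (c *s v) = c * L v)"
      using R unfolding mv_holomorphic_on_def by metis
    then obtain L where L: "\<And>i. ((\<lambda>x. F x $ i) has_derivative L i) (at p)"
      "\<And>i c v. L i (c *s v) = c * L i v"
      by metis
    show "\<exists>L. (F has_derivative L) (at p) \<and> (\<forall>c v. L (c *s v) = c *s L v)"
      by (rule exI[of _ "\<lambda>v. \<chi> i. L i v"])
        (auto simp: L vec_eq_iff intro!: has_derivative_vec_componentwise)
  qed (use R in simp)
qed

lemma mv_holomorphic_on_compose:
  assumes "mv_holomorphic_on f U" "holomorphic_map_on F S" "\<And>x. x \<in> S \<Longrightarrow> F x \<in> U"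
  shows "mv_holomorphic_on (\<lambda>x. f (F x)) S"
  unfolding mv_holomorphic_on_def
proof (intro conjI ballI)
  show "open S" using assms by (simp add: holomorphic_map_on_def)
  fix p assume p: "p \<in> S"
  obtain L where L: "(F has_derivative L) (at p)" "\<And>c v. L (c *s v) = c *s L v"
    using assms p unfolding holomorphic_map_on_def by metis
  obtain L' where L': "(f has_derivative L') (at (F p))" "\<And>c v. L' (c *s v) = c * L' v"
    using assms p unfolding mv_holomorphic_on_def by metis
  show "\<exists>L. ((\<lambda>x. f (F x)) has_derivative L) (at p) \<and> (\<forall>c v. L (c *s v) = c * L v)"
    by (rule exI[of _ "\<lambda>v. L' (L v)"]) (auto simp: L L' intro: has_derivative_compose)
qed

lemma holomorphic_map_on_linear:
  fixes F :: "complex^'a::finite \<Rightarrow> complex^'b::finite"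
  assumes "open S" "\<And>x y. F (x + y) = F x + F y" "\<And>c v. F (c *s v) = c *s F v"
  shows "holomorphic_map_on F S"
proof -
  have "F (r *\<^sub>R x) = r *\<^sub>R F x" for r x
    using assms(3)[of "of_real r" x]
    by (simp add: vec_eq_iff scaleR_conv_of_real vector_scalar_mult_def scaleR_vec_def)
  then have "bounded_linear F"
    by (simp add: linear_conv_bounded_linear[symmetric] linear_iff assms)
  then show ?thesis
    unfolding holomorphic_map_on_def using assms bounded_linear_imp_has_derivative by blast
qed

section \<open>The identity theorem\<close>

lemma bounded_linear_smult_left: "bounded_linear (\<lambda>t::complex. t *s (v::complex^'k::finite))"
  by (simp add: linear_conv_bounded_linear[symmetric] linear_iff vec_eq_iff algebra_simps)

lemma continuous_on_complex_line: "continuous_on T (\<lambda>t::complex. p + t *s (v::complex^'k::finite))"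
  by (intro continuous_intros bounded_linear.continuous_on[OF bounded_linear_smult_left])

lemma mv_holomorphic_on_complex_line:
  assumes "mv_holomorphic_on f U" "\<And>t. t \<in> T \<Longrightarrow> p + t *s v \<in> U"
  shows "(\<lambda>t. f (p + t *s v)) holomorphic_on T"
proof (rule holomorphic_onI)
  fix t assume "t \<in> T"
  then obtain L where L: "(f has_derivative L) (at (p + t *s v))" "\<And>c v. L (c *s v) = c * L v"
    using assms unfolding mv_holomorphic_on_def by metis
  have "((\<lambda>t. p + t *s v) has_derivative (\<lambda>t. t *s v)) (at t)"
    using has_derivative_add[OF has_derivative_const[of p]
        bounded_linear_imp_has_derivative[OF bounded_linear_smult_left[of v]]] by simp
  from has_derivative_compose[OF this L(1)]
  have "((\<lambda>t. f (p + t *s v)) has_field_derivative L v) (at t)"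
    unfolding has_field_derivative_def by (simp add: L mult_commute_abs)
  then show "(\<lambda>t. f (p + t *s v)) field_differentiable at t within T"
    using field_differentiable_at_within field_differentiable_def by blast
qed

lemma convex_line_preimage:
  assumes "convex (B :: (complex^'k::finite) set)" shows "convex {t. p + t *s v \<in> B}"
proof (rule convexI)
  fix x y :: complex and a b :: real
  assume h: "x \<in> {t. p + t *s v \<in> B}" "y \<in> {t. p + t *s v \<in> B}" "0 \<le> a" "0 \<le> b" "a + b = 1"
  then have b: "b = 1 - a" by simp
  have "p + (a *\<^sub>R x + b *\<^sub>R y) *s v = a *\<^sub>R (p + x *s v) + b *\<^sub>R (p + y *s v)"
    unfolding b by (simp add: vec_eq_iff scaleR_conv_of_real[where 'a=complex] algebra_simps)
  then show "a *\<^sub>R x + b *\<^sub>R y \<in> {t. p + t *s v \<in> B}"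
    using convexD[OF assms _ _ h(3-5), of "p + x *s v" "p + y *s v"] h(1,2) by simp
qed

lemma open_line_preimage:
  assumes "open (B :: (complex^'k::finite) set)" shows "open {t. p + t *s v \<in> B}"
  using open_vimage[OF assms continuous_on_complex_line[of UNIV p v]] by (simp add: vimage_def)

text \<open>The complex line through \<open>p\<close> and \<open>q\<close> meets a convex \<open>B\<close> in a convex, hence connected, plane
  domain, so the one-variable identity theorem carries the zeros near \<open>p\<close> over to \<open>q\<close>.\<close>

lemma identity_theorem_convex:
  assumes "mv_holomorphic_on f B" "convex B" "open N" "N \<subseteq> B" "p \<in> N"
    and 0: "\<And>x. x \<in> N \<Longrightarrow> f x = 0" and "q \<in> B"
  shows "f q = 0"
proof -
  define v where "v = q - p"
  define T where "T = {t. p + t *s v \<in> B}"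
  have "open B" using assms(1) by (simp add: mv_holomorphic_on_def)
  have [simp]: "p + 0 *s v = p" "p + 1 *s v = q" by (auto simp: v_def)
  have "f (p + 1 *s v) = 0"
  proof (rule analytic_continuation_open[where f = "\<lambda>t. f (p + t *s v)" and z = 1
        and s = "{t. p + t *s v \<in> N}" and s' = T and g = "\<lambda>_. 0"])
    show "open {t. p + t *s v \<in> N}" "open T"
      unfolding T_def by (intro open_line_preimage \<open>open B\<close> \<open>open N\<close>)+
    show "{t. p + t *s v \<in> N} \<noteq> {}" using \<open>p \<in> N\<close> by (auto intro!: exI[of _ 0])
    show "connected T" unfolding T_def by (intro convex_connected convex_line_preimage assms)
    show "{t. p + t *s v \<in> N} \<subseteq> T" using \<open>N \<subseteq> B\<close> by (auto simp: T_def)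
    show "(\<lambda>t. f (p + t *s v)) holomorphic_on T"
      by (rule mv_holomorphic_on_complex_line[OF assms(1)]) (simp add: T_def)
      show "1 \<in> T" using \<open>q \<in> B\<close> by (simp add: T_def v_def)
  qed (use 0 in auto)
  then show ?thesis by (simp add: v_def)
qed

text \<open>The points of \<open>U\<close> at which the germ of \<open>f\<close> is zero form an open set, and by the convex case on
  balls so do the others; a connected \<open>U\<close> cannot contain points of both kinds.\<close>

lemma identity_theorem_frequently:
  assumes f: "mv_holomorphic_on f U" and "connected U" "p \<in> U" "q \<in> U" "f q \<noteq> 0"
  shows "\<exists>\<^sub>F x in nhds p. f x \<noteq> 0"
proof (rule ccontr)
  assume "\<not> ?thesis"
  then have p: "\<forall>\<^sub>F x in nhds p. f x = 0" by (simp add: frequently_def)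
  define Z where "Z = {x\<in>U. \<forall>\<^sub>F y in nhds x. f y = 0}"
  have "open U" using f by (simp add: mv_holomorphic_on_def)
  have oZ: "open Z"
  proof (subst open_subopen, intro ballI)
    fix x assume "x \<in> Z"
    then obtain T where "open T" "x \<in> T" "\<And>y. y \<in> T \<Longrightarrow> f y = 0" "x \<in> U"
      unfolding Z_def eventually_nhds by auto
    then show "\<exists>T. open T \<and> x \<in> T \<and> T \<subseteq> Z"
      using \<open>open U\<close> by (intro exI[of _ "T \<inter> U"]) (auto simp: Z_def eventually_nhds)
  qed
  moreover have "open (U - Z)"
  proof (subst open_subopen, intro ballI)
    fix x assume x: "x \<in> U - Z"
    then obtain e where e: "e > 0" "ball x e \<subseteq> U"
      using \<open>open U\<close> by (meson DiffE open_contains_ball)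
    have "ball x e \<inter> Z = {}"
    proof (rule ccontr)
      assume "ball x e \<inter> Z \<noteq> {}"
      then obtain y T where y: "y \<in> ball x e" "open T" "y \<in> T" "\<And>y. y \<in> T \<Longrightarrow> f y = 0"
        unfolding Z_def eventually_nhds by blast
      have "f z = 0" if "z \<in> ball x e" for z
        by (rule identity_theorem_convex[of f "ball x e" "T \<inter> ball x e" y])
          (use y e that in \<open>auto intro: mv_holomorphic_on_subset[OF f]\<close>)
      then have "x \<in> Z"
        using x e unfolding Z_def eventually_nhds by (auto intro!: exI[of _ "ball x e"])
      then show False using x by auto
    qed
    then show "\<exists>T. open T \<and> x \<in> T \<and> T \<subseteq> U - Z"
      using e by (intro exI[of _ "ball x e"]) auto
  qed
  moreover have "p \<in> Z" using p \<open>p \<in> U\<close> by (simp add: Z_def)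
  moreover have "q \<in> U - Z"
    using \<open>q \<in> U\<close> \<open>f q \<noteq> 0\<close> eventually_nhds_x_imp_x by (fastforce simp: Z_def)
  ultimately show False
    using connectedD[OF \<open>connected U\<close>, of Z "U - Z"] by (auto simp: Z_def)
qed

section \<open>Uniqueness from a totally real subspace\<close>

text \<open>The fixed space of an antilinear involution \<open>\<tau>\<close> is a maximally totally real subspace: every \<open>q\<close> is
  \<open>p + \<i> v\<close> with \<open>p\<close> and \<open>v\<close> fixed. On the complex line \<open>t \<mapsto> p + t v\<close> the function vanishes at all
  real \<open>t\<close> that stay in the ball, hence also at \<open>t = \<i>\<close>.\<close>

lemma vanishing_on_real_points:
  fixes K :: "complex^'k::finite \<Rightarrow> complex"
  assumes K: "mv_holomorphic_on K (ball 0 r)"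
    and add: "\<And>x y. \<tau> (x + y) = \<tau> x + \<tau> y"
    and scl: "\<And>c v. \<tau> (c *s v) = cnj c *s \<tau> v"
    and inv: "\<And>v. \<tau> (\<tau> v) = v"
    and nrm: "\<And>v. norm (\<tau> v) = norm v"
    and 0: "\<And>y. y \<in> ball 0 r \<Longrightarrow> \<tau> y = y \<Longrightarrow> K y = 0"
    and q: "q \<in> ball 0 r"
  shows "K q = 0"
proof -
  define p where "p = (1/2) *s (q + \<tau> q)"
  define v where "v = (1/(2*\<i>)) *s (q + (-1) *s \<tau> q)"
  have \<tau>p: "\<tau> p = p" by (simp add: p_def scl add inv add.commute)
  have \<tau>v: "\<tau> v = v" unfolding v_def scl add inv by (simp add: vec_eq_iff field_simps)
  have qe: "p + \<i> *s v = q" unfolding v_def p_def by (simp add: vec_eq_iff field_simps)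
  \<comment> \<open>As \<open>\<tau>\<close> is an isometry, the starting point \<open>p\<close> of the line stays in the ball.\<close>
  have "p = (1/2) *\<^sub>R (q + \<tau> q)" by (simp add: p_def vec_eq_iff scaleR_conv_of_real[where 'a=complex] distrib_left)
  then have "norm p \<le> norm q" using norm_triangle_ineq[of q "\<tau> q"] by (simp add: nrm)
  then have p: "p \<in> ball 0 r" using q by simp
  define T where "T = {t. p + t *s v \<in> ball 0 r}"
  have "open T" unfolding T_def by (rule open_line_preimage) simp
  have "0 \<in> T" using p by (simp add: T_def)
  have "K (p + \<i> *s v) = 0"
  proof (rule analytic_continuation[where f = "\<lambda>t. K (p + t *s v)" and w = \<i>
        and S = T and U = "T \<inter> \<real>" and \<xi> = 0])
    show "(\<lambda>t. K (p + t *s v)) holomorphic_on T"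
      by (rule mv_holomorphic_on_complex_line[OF K]) (simp add: T_def)
    show "connected T" unfolding T_def by (intro convex_connected convex_line_preimage convex_ball)
    show "0 islimpt T \<inter> \<real>"
    proof (subst islimpt_approachable, intro allI impI)
      fix e :: real assume "e > 0"
      obtain d where d: "d > 0" "ball 0 d \<subseteq> T"
        using \<open>open T\<close> \<open>0 \<in> T\<close> open_contains_ball by blast
      have "complex_of_real (min d e / 2) \<in> T \<inter> \<real>" using d \<open>e > 0\<close> by (auto intro!: subsetD[OF d(2)])
      then show "\<exists>x'\<in>T \<inter> \<real>. x' \<noteq> 0 \<and> dist x' 0 < e"
        using d \<open>e > 0\<close> by (intro bexI[of _ "complex_of_real (min d e / 2)"]) auto
    qed
    show "K (p + t *s v) = 0" if "t \<in> T \<inter> \<real>" for t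
      by (rule 0) (use that \<tau>p \<tau>v in \<open>auto simp: T_def add scl Reals_cnj_iff\<close>)
    show "\<i> \<in> T" using q by (simp add: T_def qe)
  qed (use \<open>open T\<close> \<open>0 \<in> T\<close> in auto)
  then show ?thesis by (simp add: qe)
qed

section \<open>Continuity of the derivative and the holomorphic inverse function theorem\<close>

lemma norm_smult_vec: "norm (t *s (v::complex^'k::finite)) = cmod t * norm v"
  by (simp add: norm_vec_def norm_mult L2_set_right_distrib)

text \<open>The definition of holomorphy asks for differentiability at each point only, while the inverse
  function theorem needs \<open>C\<^sup>1\<close>. In each direction \<open>v\<close> the difference of the derivatives at \<open>x\<close> and \<open>p\<close>
  is the derivative at \<open>0\<close> of \<open>t \<mapsto> f (x + t v) - f (p + t v)\<close>, which the Cauchy inequality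
  bounds by a multiple of the supremum of this difference on a circle of fixed radius; uniform
  continuity of \<open>f\<close> makes the latter small as \<open>x\<close> tends to \<open>p\<close>.\<close>

lemma mv_derivative_continuous:
  fixes f :: "complex^'k::finite \<Rightarrow> complex"
  assumes f: "mv_holomorphic_on f U" and p: "p \<in> U" and e: "e > 0"
    and D: "\<And>x. x \<in> U \<Longrightarrow> (f has_derivative D x) (at x)"
  shows "\<exists>d>0. \<forall>x\<in>ball p d. x \<in> U \<and> (\<forall>v. cmod (D x v - D p v) \<le> e * norm v)"
proof -
  have "open U" using f by (simp add: mv_holomorphic_on_def)
  \<comment> \<open>Radius \<open>2 r\<close>: the point \<open>x\<close> moves within \<open>r\<close> of \<open>p\<close>, and discs of radius \<open>r\<close> around it are used.\<close>
  obtain r0 where r0: "r0 > 0" "cball p r0 \<subseteq> U" using \<open>open U\<close> p open_contains_cball by blast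
  define r where "r = r0 / 2"
  have r: "r > 0" "cball p (2 * r) \<subseteq> U" using r0 by (auto simp: r_def)
  have "uniformly_continuous_on (cball p (2*r)) f"
    using compact_uniformly_continuous mv_holomorphic_on_imp_continuous_on[OF f] r(2)
    by (metis compact_cball continuous_on_subset)
  then obtain d where d: "d > 0" "\<And>x y. x \<in> cball p (2*r) \<Longrightarrow> y \<in> cball p (2*r) \<Longrightarrow> dist x y < d \<Longrightarrow> dist (f x) (f y) < e * r"
    unfolding uniformly_continuous_on_def using e r by (metis mult_pos_pos)
  have bound: "cmod (D x v - D p v) \<le> e" if x: "x \<in> ball p (min d r)" and v: "norm v = 1" for x v
  proof -
    have in2: "x + t *s v \<in> cball p (2*r)" "p + t *s v \<in> cball p (2*r)" if "cmod t \<le> r" for t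
    proof -
      have "norm (t *s v) \<le> r" using that v by (simp add: norm_smult_vec)
      then show "x + t *s v \<in> cball p (2*r)"  "p + t *s v \<in> cball p (2*r)"
        using x r norm_triangle_ineq4[of "p - x" "t *s v"]
        by (auto simp: dist_norm algebra_simps)
    qed
    have field: "((\<lambda>t. f (x + t *s v)) has_field_derivative D x v) (at 0)" if "x \<in> U" for x
    proof -
      obtain L where L: "(f has_derivative L) (at x)" "\<And>c v. L (c *s v) = c * L v"
        using f \<open>x \<in> U\<close> unfolding mv_holomorphic_on_def by metis
      then have "D x = L" using D[OF \<open>x \<in> U\<close>] has_derivative_unique by blast
      have "((\<lambda>t. x + t *s v) has_derivative (\<lambda>t. t *s v)) (at 0)"
        using has_derivative_add[OF has_derivative_const[of x]
            bounded_linear_imp_has_derivative[OF bounded_linear_smult_left[of v]]] by simp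
      from has_derivative_compose[OF this, of f L] L(1)
      show ?thesis unfolding has_field_derivative_def \<open>D x = L\<close> by (simp add: L mult_commute_abs)
    qed
    have xp: "x \<in> U" using in2[of 0] r by auto
    let ?\<phi> = "\<lambda>t. f (x + t *s v) - f (p + t *s v)"
    have "cmod ((deriv ^^ 1) ?\<phi> 0) \<le> fact 1 * (e * r) / r ^ 1"
    proof (rule Cauchy_inequality)
      have hol: "?\<phi> holomorphic_on cball 0 r"
        by (intro holomorphic_intros mv_holomorphic_on_complex_line[OF f]) (use in2 r in auto)
      then show "?\<phi> holomorphic_on ball 0 r" by (rule holomorphic_on_subset) auto
      show "continuous_on (cball 0 r) ?\<phi>" using hol holomorphic_on_imp_continuous_on by blast
      show "cmod (?\<phi> t) \<le> e * r" if "cmod (0 - t) = r" for t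
        using d(2)[OF in2(1)[of t] in2(2)[of t]] that x by (simp add: dist_norm norm_minus_commute)
    qed (rule r)
    moreover have "deriv ?\<phi> 0 = D x v - D p v"
      by (intro DERIV_imp_deriv DERIV_diff field xp p)
    ultimately show ?thesis using r by simp
  qed
  show ?thesis
  proof (intro exI[of _ "min d r"] conjI ballI allI)
    show "0 < min d r" using d r by simp
    fix x assume x: "x \<in> ball p (min d r)"
    then have "x \<in> cball p (2 * r)" using r by auto
    then show xU: "x \<in> U" using r by auto
    fix v
    interpret X: bounded_linear "D x" using D[OF xU] by (rule has_derivative_bounded_linear)
    interpret P: bounded_linear "D p" using D[OF p] by (rule has_derivative_bounded_linear)
    show "cmod (D x v - D p v) \<le> e * norm v"
    proof (cases "v = 0")
      case True then show ?thesis by (simp add: X.zero P.zero)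
    next
      case False
      then have "cmod (D x (v /\<^sub>R norm v) - D p (v /\<^sub>R norm v)) \<le> e" by (intro bound x) auto
      also have "D x (v /\<^sub>R norm v) - D p (v /\<^sub>R norm v) = (D x v - D p v) /\<^sub>R norm v"
        by (simp add: X.scaleR P.scaleR scaleR_diff_right)
      also have "cmod \<dots> = cmod (D x v - D p v) / norm v" by (simp add: divide_inverse mult.commute)
      finally show ?thesis using False by (simp add: field_simps)
    qed
  qed
qed

text \<open>The real inverse function theorem supplies the inverse; its derivative is the inverse of a
  complex-linear bijection and therefore complex linear.\<close>

lemma holomorphic_inverse_function_theorem:
  fixes F :: "complex^'k::finite \<Rightarrow> complex^'k"
  assumes F: "holomorphic_map_on F U" and p: "p \<in> U"
    and F1: "(F has_derivative (\<lambda>v. v)) (at p)"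
  obtains A B G where "open A" "A \<subseteq> U" "p \<in> A" "open B" "homeomorphism A B F G" "holomorphic_map_on G B"
proof -
  have "open U" using F by (simp add: holomorphic_map_on_def)
  obtain D where D: "\<And>x. x \<in> U \<Longrightarrow> (F has_derivative D x) (at x)"
    and Dlin: "\<And>x c v. x \<in> U \<Longrightarrow> D x (c *s v) = c *s D x v"
    using F unfolding holomorphic_map_on_def by metis
  define F' where "F' x = Blinfun (D x)" for x
  have F': "blinfun_apply (F' x) = D x" if "x \<in> U" for x
    unfolding F'_def using D[OF that] has_derivative_bounded_linear bounded_linear_Blinfun_apply by blast
  have cont: "continuous_on U F'"
  proof (rule continuous_onI)
    fix x and e :: real assume x: "x \<in> U" and "e > 0"
    define e' where "e' = e / (2 * CARD('k))"
    have e': "e' > 0" using \<open>e > 0\<close> by (simp add: e'_def)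
    have "\<exists>d>0. \<forall>y\<in>ball x d. y \<in> U \<and> (\<forall>v. cmod (D y v $ i - D x v $ i) \<le> e' * norm v)" for i
      by (rule mv_derivative_continuous[of "\<lambda>x. F x $ i" U])
        (use F x e' in \<open>auto simp: holomorphic_map_on_componentwise
          intro: bounded_linear.has_derivative[OF bounded_linear_vec_nth D]\<close>)
    then obtain d where d: "\<And>i. d i > 0"
      "\<And>i y v. y \<in> ball x (d i) \<Longrightarrow> cmod (D y v $ i - D x v $ i) \<le> e' * norm v"
      by metis
    show "\<exists>d>0. \<forall>y\<in>U. dist y x < d \<longrightarrow> dist (F' y) (F' x) \<le> e"
    proof (intro exI[of _ "Min (range d)"] conjI ballI impI)
      show "0 < Min (range d)" using d by simp
      fix y assume y: "y \<in> U" "dist y x < Min (range d)"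
      have "norm (F' y - F' x) \<le> e"
      proof (rule norm_blinfun_bound)
        fix v
        have "norm (D y v - D x v) \<le> (\<Sum>i\<in>UNIV. cmod ((D y v - D x v) $ i))"
          unfolding norm_vec_def by (rule L2_set_le_sum) simp
        also have "\<dots> \<le> (\<Sum>i\<in>(UNIV::'k set). e' * norm v)"
          using y by (intro sum_mono) (auto intro!: d(2) simp: dist_commute)
        also have "\<dots> = (CARD('k) * e') * norm v" by simp
        also have "\<dots> \<le> e * norm v" using \<open>e > 0\<close> by (intro mult_right_mono) (auto simp: e'_def)
        finally show "norm (blinfun_apply (F' y - F' x) v) \<le> e * norm v"
          by (simp add: blinfun.diff_left F' x y)
      qed (use \<open>e > 0\<close> in simp)
      then show "dist (F' y) (F' x) \<le> e" by (simp add: dist_norm)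
    qed
  qed
  have id: "id_blinfun o\<^sub>L F' p = id_blinfun"
    using has_derivative_unique[OF D[OF p] F1] F'[OF p] by (auto intro!: blinfun_eqI)
  obtain A B G G' where *: "open A" "A \<subseteq> U" "p \<in> A" "open B" "F p \<in> B" "homeomorphism A B F G"
    "\<And>y. y \<in> B \<Longrightarrow> (G has_derivative (G' y)) (at y)"
    "\<And>y. y \<in> B \<Longrightarrow> G' y = inv (blinfun_apply (F' (G y)))"
    "\<And>y. y \<in> B \<Longrightarrow> bij (blinfun_apply (F' (G y)))"
    using inverse_function_theorem[OF \<open>open U\<close> _ cont p id] D F' by (metis (no_types, lifting))
  have "holomorphic_map_on G B"
    unfolding holomorphic_map_on_def
  proof (intro conjI ballI exI allI)
    fix y c v assume y: "y \<in> B"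
    then show "(G has_derivative G' y) (at y)" by (rule *)
    have Gy: "G y \<in> U" using y *(2,6) by (auto simp: homeomorphism_def)
    have bij: "bij (D (G y))" and G': "G' y = inv (D (G y))"
      using *(8,9)[OF y] F'[OF Gy] by auto
    have "D (G y) (c *s G' y v) = c *s v"
      by (simp add: Dlin Gy G' bij bij_is_surj surj_f_inv_f)
    then show "G' y (c *s v) = c *s G' y v"
      by (metis G' bij bij_is_inj inv_f_f)
  qed (rule *)
  with * that show thesis by blast
qed

section \<open>Splitting coordinate vectors\<close>

definition join :: "complex^'a::finite \<Rightarrow> complex^'b::finite \<Rightarrow> complex^('a+'b)" where
  "join a b = (\<chi> i. case i of Inl j \<Rightarrow> a $ j | Inr j \<Rightarrow> b $ j)"

lemma zpart_join [simp]: "zpart (join a b) = a"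
  and wpart_join [simp]: "wpart (join a b) = b"
  and join_parts [simp]: "join (zpart x) (wpart x) = x"
  by (auto simp: join_def zpart_def wpart_def vec_eq_iff split: sum.split)

lemma join_nth: "join a b $ Inl j = a $ j" "join a b $ Inr k = b $ k"
  by (auto simp: join_def)

lemma parts_eq_iff: "x = y \<longleftrightarrow> zpart x = zpart y \<and> wpart x = wpart y"
  by (metis join_parts)

lemma part_linear [simp]:
  "zpart (x + y) = zpart x + zpart y" "zpart (c *s x) = c *s zpart x"
  "wpart (x + y) = wpart x + wpart y" "wpart (c *s x) = c *s wpart x"
  "zpart 0 = 0" "wpart 0 = 0" "zpart (r *\<^sub>R x) = r *\<^sub>R zpart x" "wpart (r *\<^sub>R x) = r *\<^sub>R wpart x"
  by (auto simp: zpart_def wpart_def vec_eq_iff)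

lemma join_linear:
  "join (a + a') (b + b') = join a b + join a' b'"
  "join (c *s a) (c *s b) = c *s join a b" "join 0 0 = 0"
  "join (r *\<^sub>R a) (r *\<^sub>R b) = r *\<^sub>R join a b"
  by (auto simp: parts_eq_iff)

lemma cnjv_simps [simp]:
  "cnjv (x + y) = cnjv x + cnjv y" "cnjv (c *s x) = cnj c *s cnjv x" "cnjv (cnjv x) = x" "cnjv 0 = 0"
  "norm (cnjv x) = norm x" "cnjv (r *\<^sub>R x) = r *\<^sub>R cnjv x"
  by (auto simp: cnjv_def vec_eq_iff norm_vec_def)

lemma cnjv_parts [simp]: "zpart (cnjv x) = cnjv (zpart x)" "wpart (cnjv x) = cnjv (wpart x)"
  by (auto simp: cnjv_def vec_eq_iff norm_vec_def zpart_def wpart_def)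

lemma bounded_linear_zpart: "bounded_linear zpart"
  and bounded_linear_wpart: "bounded_linear wpart"
  and bounded_linear_cnjv: "bounded_linear cnjv"
  and bounded_linear_join: "bounded_linear (\<lambda>(a, b). join a b)"
  by (auto simp: linear_conv_bounded_linear[symmetric] linear_iff join_linear)

lemmas continuous_on_parts [continuous_intros] =
  bounded_linear.continuous_on[OF bounded_linear_zpart]
  bounded_linear.continuous_on[OF bounded_linear_wpart]
  bounded_linear.continuous_on[OF bounded_linear_cnjv]

lemmas tendsto_parts [tendsto_intros] =
  bounded_linear.tendsto[OF bounded_linear_zpart]
  bounded_linear.tendsto[OF bounded_linear_wpart]
  bounded_linear.tendsto[OF bounded_linear_cnjv]

lemma continuous_on_join [continuous_intros]:
  assumes "continuous_on S f" "continuous_on S g"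
  shows "continuous_on S (\<lambda>x. join (f x) (g x))"
  using bounded_linear.continuous_on[OF bounded_linear_join continuous_on_Pair[OF assms]] by simp

lemma tendsto_join [tendsto_intros]:
  assumes "(f \<longlongrightarrow> a) F" "(g \<longlongrightarrow> b) F"
  shows "((\<lambda>x. join (f x) (g x)) \<longlongrightarrow> join a b) F"
  using bounded_linear.tendsto[OF bounded_linear_join tendsto_Pair[OF assms]] by simp

lemma has_derivative_join:
  assumes "(f has_derivative f') (at p)" "(g has_derivative g') (at p)"
  shows "((\<lambda>x. join (f x) (g x)) has_derivative (\<lambda>v. join (f' v) (g' v))) (at p)"
  using bounded_linear.has_derivative[OF bounded_linear_join has_derivative_Pair[OF assms]] by simp

lemma holomorphic_map_on_join:
  assumes "holomorphic_map_on F S" "holomorphic_map_on G S"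
  shows "holomorphic_map_on (\<lambda>x. join (F x) (G x)) S"
  unfolding holomorphic_map_on_componentwise
proof (intro conjI allI)
  show "open S" using assms by (simp add: holomorphic_map_on_def)
  fix i show "mv_holomorphic_on (\<lambda>x. join (F x) (G x) $ i) S"
    using assms by (cases i) (auto simp: join_nth holomorphic_map_on_componentwise)
qed

lemma holomorphic_map_on_compose:
  assumes "holomorphic_map_on G U" "holomorphic_map_on F S" "\<And>x. x \<in> S \<Longrightarrow> F x \<in> U"
  shows "holomorphic_map_on (\<lambda>x. G (F x)) S"
  using mv_holomorphic_on_compose[OF _ assms(2,3)] assms(1,2)
  unfolding holomorphic_map_on_componentwise by auto

lemma holomorphic_map_on_const: "open S \<Longrightarrow> holomorphic_map_on (\<lambda>_. c) S"
  unfolding holomorphic_map_on_def by (auto intro!: exI[of _ "\<lambda>_. 0"])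

lemma mv_holomorphic_on_cnj:
  assumes f: "mv_holomorphic_on f U"
  shows "mv_holomorphic_on (\<lambda>x. cnj (f (cnjv x))) (cnjv -` U)"
  unfolding mv_holomorphic_on_def
proof (intro conjI ballI)
  have "open U" using f by (simp add: mv_holomorphic_on_def)
  then show "open (cnjv -` U)"
    by (intro open_vimage) (auto intro!: continuous_intros)
  fix p assume "p \<in> cnjv -` U"
  then obtain L where L: "(f has_derivative L) (at (cnjv p))" "\<And>c v. L (c *s v) = c * L v"
    using f unfolding mv_holomorphic_on_def by auto
  have "((\<lambda>x. cnj (f (cnjv x))) has_derivative (\<lambda>v. cnj (L (cnjv v)))) (at p)"
    using bounded_linear.has_derivative[OF bounded_linear_cnj
        has_derivative_compose[OF bounded_linear_imp_has_derivative[OF bounded_linear_cnjv] L(1)]] .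
  then show "\<exists>L. ((\<lambda>x. cnj (f (cnjv x))) has_derivative L) (at p) \<and> (\<forall>c v. L (c *s v) = c * L v)"
    by (intro exI[of _ "\<lambda>v. cnj (L (cnjv v))"]) (simp add: L)
qed

lemma norm_join: "norm (join a b) = sqrt ((norm a)\<^sup>2 + (norm b)\<^sup>2)"
proof -
  have "(\<Sum>i\<in>UNIV. (norm (join a b $ i))\<^sup>2) = (\<Sum>i\<in>UNIV. (norm (a $ i))\<^sup>2) + (\<Sum>i\<in>UNIV. (norm (b $ i))\<^sup>2)"
    by (subst UNIV_Plus_UNIV[symmetric], subst sum.Plus) (auto simp: join_nth)
  then show ?thesis
    by (simp add: norm_vec_def L2_set_def sum_nonneg)
qed

lemma norm_join_le: "norm (join a b) \<le> norm a + norm b"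
  by (simp add: norm_join sqrt_sum_squares_le_sum)

section \<open>Uniqueness on the complexification\<close>

text \<open>In the coordinates \<open>(z, \<zeta>, u)\<close>, the fixed points are those with \<open>\<zeta>\<close> the conjugate of \<open>z\<close> and \<open>u\<close>
  real.\<close>

definition conj_swap :: "complex^('n::finite+('n+'d::finite)) \<Rightarrow> complex^('n+('n+'d))" where
  "conj_swap x = join (cnjv (zpart (wpart x))) (join (cnjv (zpart x)) (cnjv (wpart (wpart x))))"

lemma conj_swap_simps:
  "conj_swap (x + y) = conj_swap x + conj_swap y"
  "conj_swap (c *s x) = cnj c *s conj_swap x"
  "conj_swap (conj_swap x) = x"
  "norm (conj_swap x) = norm x"
proof -
  show "norm (conj_swap x) = norm x"
    using norm_join[of "zpart x" "wpart x"] norm_join[of "zpart (wpart x)" "wpart (wpart x)"]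
    by (simp add: conj_swap_def norm_join algebra_simps)
qed (auto simp: conj_swap_def parts_eq_iff)

text \<open>The map \<open>(z, \<zeta>, \<omega>) \<mapsto> (z, \<zeta>, (\<omega> + q(z, \<zeta>, \<omega>)) / 2)\<close> is the change of coordinates that
  makes the antiholomorphic involution of the next proof linear.\<close>

lemma has_derivative_halfway:
  fixes q :: "complex^('n::finite+('n+'d::finite)) \<Rightarrow> complex^'d"
  assumes "(q has_derivative L) (at x)"
  shows "((\<lambda>x. join (zpart x) (join (zpart (wpart x)) ((1/2) *\<^sub>R (wpart (wpart x) + q x))))
    has_derivative (\<lambda>v. join (zpart v) (join (zpart (wpart v)) ((1/2) *\<^sub>R (wpart (wpart v) + L v))))) (at x)"
  by (intro has_derivative_join has_derivative_scaleR_right has_derivative_add assms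
      bounded_linear.has_derivative[OF bounded_linear_zpart]
      bounded_linear.has_derivative[OF bounded_linear_wpart] has_derivative_ident)

text \<open>With \<open>\<omega>\<close> standing for the conjugate of \<open>w\<close>, the fixed points of \<open>\<sigma>\<close> are the triples in which
  \<open>\<zeta>\<close> and \<open>\<omega>\<close> are the conjugates of \<open>z\<close> and \<open>w = q(z, \<zeta>, \<omega>)\<close>, so they represent the points
  \<open>(z, w)\<close> of the real submanifold \<open>M\<close> given by \<open>w = q(z, cnj z, cnj w)\<close>. The reality condition makes \<open>\<sigma>\<close> an antiholomorphic involution. Such an
  involution is straightened by averaging: \<open>\<Theta>(z, \<zeta>, \<omega>) = (z, \<zeta>, (\<omega> + q) / 2)\<close> conjugates \<open>\<sigma>\<close> into
  the antilinear involution \<^const>\<open>conj_swap\<close>, and by the normalisation of \<open>q\<close> its derivative at \<open>0\<close>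
  is the identity. In the coordinates given by \<open>\<Theta>\<close> the function \<open>H\<close> thus vanishes on a totally real
  subspace of maximal dimension.\<close>

lemma vanishing_on_complexification:
  fixes q :: "complex^('n::finite+('n+'d::finite)) \<Rightarrow> complex^'d"
    and H :: "complex^('n+('n+'d)) \<Rightarrow> complex"
  defines "\<sigma> \<equiv> \<lambda>x. join (cnjv (zpart (wpart x))) (join (cnjv (zpart x)) (cnjv (q x)))"
  assumes q: "holomorphic_map_on q \<Omega>" "0 \<in> \<Omega>"
    and n1: "\<forall>\<^sub>F v in nhds 0. q (join 0 v) = wpart v"
    and n2: "\<forall>\<^sub>F x in nhds 0. q (join (zpart x) (join 0 (wpart x))) = wpart x"
    and re: "\<forall>\<^sub>F x in nhds 0. q (\<sigma> x) = cnjv (wpart (wpart x))"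
    and H: "mv_holomorphic_on H S" "0 \<in> S"
    and H0: "\<forall>\<^sub>F x in nhds 0. \<sigma> x = x \<longrightarrow> H x = 0"
  shows "\<forall>\<^sub>F x in nhds 0. H x = 0"
proof -
  define \<Theta> where "\<Theta> x = join (zpart x) (join (zpart (wpart x)) ((1/2) *\<^sub>R (wpart (wpart x) + q x)))" for x
  have \<Theta>hol: "holomorphic_map_on \<Theta> \<Omega>"
    unfolding holomorphic_map_on_def
  proof (intro conjI ballI)
    show "open \<Omega>" using q by (simp add: holomorphic_map_on_def)
    fix x assume "x \<in> \<Omega>"
    then obtain L where L: "(q has_derivative L) (at x)" "\<And>c v. L (c *s v) = c *s L v"
      using q unfolding holomorphic_map_on_def by metis
    have half: "(1/2) *\<^sub>R (c *s u + c *s v) = c *s ((1/2) *\<^sub>R (u + v))" for c and u v :: "complex^'d"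
      by (simp add: vec_eq_iff algebra_simps)
    show "\<exists>L. (\<Theta> has_derivative L) (at x) \<and> (\<forall>c v. L (c *s v) = c *s L v)"
      unfolding \<Theta>_def
      by (rule exI, rule conjI, rule has_derivative_halfway[OF L(1)])
        (simp add: L(2) half join_linear)
  qed
  have q0: "q 0 = 0"
    using eventually_nhds_x_imp_x[OF n1] by (simp add: join_linear)
  have \<Theta>0: "\<Theta> 0 = 0" by (simp add: \<Theta>_def q0 join_linear)
  obtain L where L: "(q has_derivative L) (at 0)"
    using q unfolding holomorphic_map_on_def by metis
  interpret L: bounded_linear L using L by (rule has_derivative_bounded_linear)
  \<comment> \<open>The two normalisations determine the derivative of \<open>q\<close> at \<open>0\<close>: it is the projection to \<open>\<omega>\<close>.\<close>
  have L1: "L (join 0 v) = wpart v" for v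
  proof -
    have bl: "bounded_linear (\<lambda>v. join 0 v :: complex^('n+('n+'d)))"
      by (auto simp: linear_conv_bounded_linear[symmetric] linear_iff parts_eq_iff)
    have "((\<lambda>v. q (join 0 v)) has_derivative (\<lambda>v. L (join 0 v))) (at 0)"
      using has_derivative_compose[OF bounded_linear_imp_has_derivative[OF bl], of q L] L
      by (simp add: join_linear)
    then have "(wpart has_derivative (\<lambda>v. L (join 0 v))) (at 0)"
      by (rule has_derivative_transform_eventually)
        (use n1 eventually_nhds_x_imp_x[OF n1] in \<open>auto simp: eventually_at_filter elim: eventually_mono\<close>)
    from has_derivative_unique[OF this bounded_linear_imp_has_derivative[OF bounded_linear_wpart]]
    show ?thesis by metis
  qed
  have L2: "L (join z 0) = 0" for z
  proof -
    have bl: "bounded_linear (\<lambda>x::complex^('n+'d). join (zpart x) (join 0 (wpart x)) :: complex^('n+('n+'d)))"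
      by (auto simp: linear_conv_bounded_linear[symmetric] linear_iff parts_eq_iff)
    have "((\<lambda>x. q (join (zpart x) (join 0 (wpart x)))) has_derivative (\<lambda>x. L (join (zpart x) (join 0 (wpart x))))) (at 0)"
      using has_derivative_compose[OF bounded_linear_imp_has_derivative[OF bl], of q L] L
      by (simp add: join_linear)
    then have "(wpart has_derivative (\<lambda>x. L (join (zpart x) (join 0 (wpart x))))) (at 0)"
      by (rule has_derivative_transform_eventually)
        (use n2 eventually_nhds_x_imp_x[OF n2] in \<open>auto simp: eventually_at_filter elim: eventually_mono\<close>)
    from fun_cong[OF has_derivative_unique[OF this bounded_linear_imp_has_derivative[OF bounded_linear_wpart]],
        of "join z 0"]
    show ?thesis by (simp add: join_linear)
  qed
  have Lw: "L v = wpart (wpart v)" for v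
  proof -
    have "v = join (zpart v) 0 + join 0 (wpart v)" by (simp add: parts_eq_iff)
    then show ?thesis by (metis L.add L1 L2 add_0)
  qed
  have "(1/2) *\<^sub>R (u + u) = u" for u :: "complex^'d" by (simp add: vec_eq_iff scaleR_conv_of_real[where 'a=complex])
  then have "(\<Theta> has_derivative (\<lambda>v. v)) (at 0)"
    using has_derivative_halfway[OF L] by (simp add: \<Theta>_def[abs_def] Lw)
  then obtain A B G where *: "open A" "A \<subseteq> \<Omega>" "0 \<in> A" "open B" "homeomorphism A B \<Theta> G" "holomorphic_map_on G B"
    using holomorphic_inverse_function_theorem[OF \<Theta>hol q(2)] by metis
  have GT: "G (\<Theta> x) = x" if "x \<in> A" for x using *(5) that by (simp add: homeomorphism_def)
  have TG: "\<Theta> (G y) = y" "G y \<in> A" if "y \<in> B" for y using *(5) that by (auto simp: homeomorphism_def)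
  have "0 \<in> B" using *(3,5) \<Theta>0 by (metis homeomorphism_def imageI)
  have G0: "G 0 = 0" using GT[of 0] \<Theta>0 *(3) by simp
  have Gt: "(G \<longlongrightarrow> 0) (nhds 0)"
    using *(4,5) \<open>0 \<in> B\<close> G0 unfolding homeomorphism_def
    by (metis continuous_on_eq_continuous_at isContD isCont_def tendsto_at_iff_tendsto_nhds)
  have qt: "(q \<longlongrightarrow> 0) (nhds 0)"
    using has_derivative_continuous[OF L] q0 by (metis isCont_def tendsto_at_iff_tendsto_nhds)
  have \<sigma>t: "(\<sigma> \<longlongrightarrow> 0) (nhds 0)"
  proof -
    let ?o = "0 :: complex^('n+('n+'d))"
    have "(\<sigma> \<longlongrightarrow> join (cnjv (zpart (wpart ?o))) (join (cnjv (zpart ?o)) (cnjv 0))) (nhds 0)"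
      unfolding \<sigma>_def by (intro tendsto_intros qt filterlim_ident)
    then show ?thesis by (simp add: join_linear)
  qed
  have "\<forall>\<^sub>F x in nhds 0. \<sigma> x \<in> A \<and> q (\<sigma> x) = cnjv (wpart (wpart x)) \<and> (\<sigma> x = x \<longrightarrow> H x = 0) \<and> x \<in> S"
    using H mv_holomorphic_on_def
    by (intro eventually_conj re H0 eventually_compose_filterlim[OF _ \<sigma>t] eventually_nhds_in_open *) auto
  from eventually_compose_filterlim[OF this Gt]
  have "\<forall>\<^sub>F y in nhds 0. y \<in> B \<and> \<sigma> (G y) \<in> A \<and> q (\<sigma> (G y)) = cnjv (wpart (wpart (G y))) \<and>
      (\<sigma> (G y) = G y \<longrightarrow> H (G y) = 0) \<and> G y \<in> S"
    using eventually_nhds_in_open[OF *(4) \<open>0 \<in> B\<close>] by eventually_elim blast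
  then obtain e where e: "e > 0" and P: "\<And>y. y \<in> ball 0 e \<Longrightarrow> y \<in> B \<and> \<sigma> (G y) \<in> A \<and>
      q (\<sigma> (G y)) = cnjv (wpart (wpart (G y))) \<and> (\<sigma> (G y) = G y \<longrightarrow> H (G y) = 0) \<and> G y \<in> S"
    by (auto simp: eventually_nhds_metric dist_commute)
  have K: "H (G y) = 0" if "y \<in> ball 0 e" for y
  proof (rule vanishing_on_real_points[where \<tau> = conj_swap and K = "\<lambda>y. H (G y)"])
    have "holomorphic_map_on G (ball 0 e)"
      using *(6) P unfolding holomorphic_map_on_def by blast
    then show "mv_holomorphic_on (\<lambda>y. H (G y)) (ball 0 e)"
      by (rule mv_holomorphic_on_compose[OF H(1)]) (use P in blast)
    fix y :: "complex^('n+('n+'d))" assume y: "y \<in> ball 0 e" "conj_swap y = y"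
    note Py = P[OF y(1)]
    \<comment> \<open>\<open>\<Theta>\<close> intertwines the involutions, so by injectivity a fixed point of one comes from one of the other.\<close>
    have "\<Theta> (\<sigma> (G y)) = conj_swap (\<Theta> (G y))"
      using Py by (simp add: \<Theta>_def conj_swap_def \<sigma>_def parts_eq_iff add.commute)
    then have "\<Theta> (\<sigma> (G y)) = \<Theta> (G y)" using y Py TG by simp
    then have "\<sigma> (G y) = G y" using Py GT TG by metis
    then show "H (G y) = 0" using Py by blast
  qed (use that in \<open>simp_all add: conj_swap_simps\<close>)
  have "(\<Theta> \<longlongrightarrow> 0) (nhds 0)"
  proof -
    have "isCont \<Theta> 0" using \<Theta>hol q(2) unfolding holomorphic_map_on_def
      using has_derivative_continuous by blast
    then show ?thesis using \<Theta>0 by (metis isCont_def tendsto_at_iff_tendsto_nhds)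
  qed
  then have "\<forall>\<^sub>F x in nhds 0. \<Theta> x \<in> ball 0 e"
    by (rule eventually_compose_filterlim[rotated])
      (rule eventually_nhds_in_open, use e in simp_all)
  moreover have "\<forall>\<^sub>F x in nhds 0. x \<in> A" by (intro eventually_nhds_in_open *)
  ultimately show ?thesis
    by eventually_elim (use K GT in metis)
qed

section \<open>Independence of z\<close>

text \<open>The equation on \<open>M\<close> extends to the complexification as
  \<open>f(z, q) F\<^sup>*(\<zeta>, \<omega>) = g(z, q) G\<^sup>*(\<zeta>, \<omega>)\<close> with \<open>q = Q(z, \<zeta>, \<omega>)\<close>, where the star conjugates a
  function and its arguments. For fixed \<open>(\<zeta>, \<omega>)\<close> outside the common zeros of \<open>F\<^sup>*\<close> and \<open>G\<^sup>*\<close> the vectors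
  \<open>(f, g)\<close> at \<open>(z, q)\<close>, for the various \<open>z\<close>, are all orthogonal to the same nonzero vector, hence
  proportional; so their determinant \<open>D\<close> for a pair \<open>z, z'\<close> vanishes on a nonempty open set of
  \<open>(\<zeta>, \<omega>)\<close> and therefore identically. Putting \<open>\<zeta> = 0\<close> only now, where \<open>Q(z, 0, \<omega>) = \<omega>\<close>, allows
  \<open>F\<^sup>*\<close> and \<open>G\<^sup>*\<close> both to vanish on \<open>\<zeta> = 0\<close>.

  The functions \<open>F\<close> and \<open>G\<close> are kept general because the two parts of the theorem use
  \<open>(F, G) = (f, g)\<close> and \<open>(F, G) = (g, f)\<close>.\<close>

lemma quotient_independent_of_z:
  fixes M :: "(complex^('n::finite+'d::finite)) set"
    and f g F G :: "complex^('n+'d) \<Rightarrow> complex"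
  assumes norm_coord: "normal_coordinates M Q"
    and hol: "mv_holomorphic_on f S" "mv_holomorphic_on g S"
      "mv_holomorphic_on F S" "mv_holomorphic_on G S" and "0 \<in> S"
    and eq: "\<And>p. p \<in> M \<inter> S \<Longrightarrow> f p * cnj (F p) = g p * cnj (G p)"
    and nz: "\<exists>\<^sub>F p in nhds 0. F p \<noteq> 0 \<or> G p \<noteq> 0"
  obtains s where "s > 0" "\<And>z w. norm z < s \<Longrightarrow> norm w < s \<Longrightarrow> join z w \<in> S"
    "\<And>z z' w. norm z < s \<Longrightarrow> norm z' < s \<Longrightarrow> norm w < s \<Longrightarrow>
       f (join z w) * g (join z' w) = g (join z w) * f (join z' w)"
proof -
  define q :: "complex^('n+('n+'d)) \<Rightarrow> complex^'d"
    where "q x = Q (zpart x) (zpart (wpart x)) (wpart (wpart x))" for x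
  obtain \<Omega> where "0 \<in> \<Omega>" and qcomp: "\<And>j. mv_holomorphic_on (\<lambda>x. q x $ j) \<Omega>"
    using norm_coord unfolding normal_coordinates_def holomorphic_map_near_0_def q_def by blast
  have "open \<Omega>" using qcomp by (simp add: mv_holomorphic_on_def)
  then have q: "holomorphic_map_on q \<Omega>" using qcomp by (simp add: holomorphic_map_on_componentwise)
  have "open S" using hol by (simp add: mv_holomorphic_on_def)
  have parts_t: "((\<lambda>x::complex^('n+'d). (zpart x, wpart x)) \<longlongrightarrow> (0, 0)) (nhds 0)"
  proof -
    have "((\<lambda>x. (zpart x, wpart x)) \<longlongrightarrow> (zpart (0::complex^('n+'d)), wpart (0::complex^('n+'d)))) (nhds 0)"
      by (intro tendsto_intros filterlim_ident)
    then show ?thesis by simp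
  qed
  have parts3_t: "((\<lambda>x::complex^('n+('n+'d)). (cnjv (zpart (wpart x)), cnjv (zpart x), cnjv (wpart (wpart x)))) \<longlongrightarrow> (0, 0, 0)) (nhds 0)"
  proof -
    let ?o = "0 :: complex^('n+('n+'d))"
    have "((\<lambda>x. (cnjv (zpart (wpart x)), cnjv (zpart x), cnjv (wpart (wpart x)))) \<longlongrightarrow>
        (cnjv (zpart (wpart ?o)), cnjv (zpart ?o), cnjv (wpart (wpart ?o)))) (nhds 0)"
      by (intro tendsto_intros filterlim_ident)
    then show ?thesis by simp
  qed
  have n1: "\<forall>\<^sub>F v in nhds 0. q (join 0 v) = wpart v"
    using eventually_compose_filterlim[OF _ parts_t, of "\<lambda>(\<zeta>, \<omega>). Q 0 \<zeta> \<omega> = \<omega>"] norm_coord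
    unfolding normal_coordinates_def q_def by simp
  have n2: "\<forall>\<^sub>F x in nhds 0. q (join (zpart x) (join 0 (wpart x))) = wpart x"
    using eventually_compose_filterlim[OF _ parts_t, of "\<lambda>(z, \<omega>). Q z 0 \<omega> = \<omega>"] norm_coord
    unfolding normal_coordinates_def q_def by simp
  define \<sigma> where "\<sigma> x = join (cnjv (zpart (wpart x))) (join (cnjv (zpart x)) (cnjv (q x)))" for x
  have re: "\<forall>\<^sub>F x in nhds 0. q (\<sigma> x) = cnjv (wpart (wpart x))"
    using eventually_compose_filterlim[OF _ parts3_t, of "\<lambda>(z, \<zeta>, w). Q z \<zeta> (Qbar Q \<zeta> z w) = w"] norm_coord
    unfolding normal_coordinates_def by (simp add: Qbar_def \<sigma>_def q_def)
  have q0: "q 0 = 0"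
    using eventually_nhds_x_imp_x[OF n1] by (simp add: join_linear)
  have cq: "continuous_on \<Omega> q" using q unfolding holomorphic_map_on_def
    by (meson continuous_at_imp_continuous_on has_derivative_continuous)
  \<comment> \<open>The point \<open>(z, w)\<close> that belongs to the point \<open>(z, \<zeta>, \<omega>)\<close> of the complexification.\<close>
  define \<pi> where "\<pi> x = join (zpart x) (q x)" for x
  have \<pi>_cont: "continuous_on \<Omega> \<pi>"
    unfolding \<pi>_def by (intro continuous_intros cq)
  have zhol: "holomorphic_map_on zpart T" if "open T" for T :: "(complex^('n+('n+'d))) set"
    by (rule holomorphic_map_on_linear) (use that in auto)
  have whol: "holomorphic_map_on wpart T" if "open T" for T :: "(complex^('n+('n+'d))) set"
    by (rule holomorphic_map_on_linear) (use that in auto)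
  have \<pi>hol: "holomorphic_map_on \<pi> \<Omega>"
    unfolding \<pi>_def by (intro holomorphic_map_on_join q zhol \<open>open \<Omega>\<close>)
  have \<pi>0: "\<pi> 0 = 0" by (simp add: \<pi>_def q0 join_linear)
  define S' where "S' = (\<Omega> \<inter> \<pi> -` S) \<inter> {x. cnjv (wpart x) \<in> S}"
  have "open S'"
    unfolding S'_def
    by (intro open_Int continuous_open_preimage[OF \<pi>_cont \<open>open \<Omega>\<close> \<open>open S\<close>])
      (use open_vimage[OF \<open>open S\<close>, of "\<lambda>x::complex^('n+('n+'d)). cnjv (wpart x)"]
        in \<open>simp add: vimage_def continuous_intros\<close>)
  have "0 \<in> S'" using \<open>0 \<in> S\<close> \<open>0 \<in> \<Omega>\<close> \<pi>0 by (simp add: S'_def)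
  define H where "H x = f (\<pi> x) * cnj (F (cnjv (wpart x))) - g (\<pi> x) * cnj (G (cnjv (wpart x)))" for x
  have \<pi>S': "holomorphic_map_on \<pi> S'"
    using \<pi>hol \<open>open S'\<close> unfolding holomorphic_map_on_def S'_def by blast
  have Hhol: "mv_holomorphic_on H S'"
    unfolding H_def
    by (intro mv_holomorphic_on_diff mv_holomorphic_on_mult
        mv_holomorphic_on_compose[OF hol(1) \<pi>S'] mv_holomorphic_on_compose[OF hol(2) \<pi>S']
        mv_holomorphic_on_compose[OF mv_holomorphic_on_cnj[OF hol(3)] whol[OF \<open>open S'\<close>]]
        mv_holomorphic_on_compose[OF mv_holomorphic_on_cnj[OF hol(4)] whol[OF \<open>open S'\<close>]])
      (auto simp: S'_def)
  have \<pi>t: "(\<pi> \<longlongrightarrow> 0) (nhds 0)"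
    using \<pi>_cont \<open>open \<Omega>\<close> \<open>0 \<in> \<Omega>\<close> \<pi>0
    by (metis continuous_on_eq_continuous_at isCont_def tendsto_at_iff_tendsto_nhds)
  have "\<forall>\<^sub>F p in nhds 0. p \<in> M \<longleftrightarrow> wpart p = Q (zpart p) (cnjv (zpart p)) (cnjv (wpart p))"
    using norm_coord by (simp add: normal_coordinates_def)
  from eventually_compose_filterlim[OF this \<pi>t]
  have "\<forall>\<^sub>F x in nhds 0. \<pi> x \<in> M \<longleftrightarrow> q x = Q (zpart x) (cnjv (zpart x)) (cnjv (q x))"
    by (simp add: \<pi>_def)
  moreover have "\<forall>\<^sub>F x in nhds 0. \<pi> x \<in> S"
    using eventually_compose_filterlim[OF _ \<pi>t] eventually_nhds_in_open[OF \<open>open S\<close> \<open>0 \<in> S\<close>] by blast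
  ultimately have H0: "\<forall>\<^sub>F x in nhds 0. \<sigma> x = x \<longrightarrow> H x = 0"
  proof eventually_elim
    fix x assume M: "\<pi> x \<in> M \<longleftrightarrow> q x = Q (zpart x) (cnjv (zpart x)) (cnjv (q x))" and S: "\<pi> x \<in> S"
    show "\<sigma> x = x \<longrightarrow> H x = 0"
    proof
      assume "\<sigma> x = x"
      then have *: "cnjv (zpart (wpart x)) = zpart x" "cnjv (zpart x) = zpart (wpart x)" "cnjv (q x) = wpart (wpart x)"
        unfolding \<sigma>_def by (metis zpart_join wpart_join)+
      have "q x = Q (zpart x) (cnjv (zpart x)) (cnjv (q x))"
        unfolding *(2,3) by (rule q_def)
      then have "\<pi> x \<in> M \<inter> S" using M S by blast
      \<comment> \<open>At a fixed point of \<open>\<sigma>\<close>, both pairs of functions are evaluated at the same point of \<open>M\<close>.\<close>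
      moreover have "cnjv (wpart x) = \<pi> x"
        using * by (simp add: \<pi>_def parts_eq_iff flip: *(3))
      ultimately show "H x = 0" using eq by (simp add: H_def)
    qed
  qed
  have "\<forall>\<^sub>F x in nhds 0. H x = 0"
    by (rule vanishing_on_complexification[OF q \<open>0 \<in> \<Omega>\<close> n1 n2 _ Hhol \<open>0 \<in> S'\<close>])
      (use re H0 in \<open>simp_all add: \<sigma>_def\<close>)
  then have "\<forall>\<^sub>F x in nhds 0. H x = 0 \<and> x \<in> S'"
    by (intro eventually_conj eventually_nhds_in_open \<open>open S'\<close> \<open>0 \<in> S'\<close>)
  then obtain r1 where r1: "r1 > 0" "\<And>x. norm x < r1 \<Longrightarrow> H x = 0 \<and> x \<in> S'"
    by (auto simp: eventually_nhds_metric)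
  have "\<forall>\<^sub>F x in nhds (0::complex^('n+'d)). q (join (zpart x) (join 0 (wpart x))) = wpart x \<and> x \<in> S"
    by (intro eventually_conj eventually_nhds_in_open \<open>open S\<close> \<open>0 \<in> S\<close> n2)
  then obtain r2 where r2: "r2 > 0" "\<And>x. norm x < r2 \<Longrightarrow> q (join (zpart x) (join 0 (wpart x))) = wpart x \<and> x \<in> S"
    by (auto simp: eventually_nhds_metric)
  \<comment> \<open>Half the radius: a vector with both parts shorter than \<open>s\<close> is shorter than \<open>r1\<close> and \<open>r2\<close>.\<close>
  define s where "s = min r1 r2 / 2"
  have s: "s > 0" using r1 r2 by (simp add: s_def)
  have small1: "norm (join a b) < r1" "norm (join a b) < r2" if "norm a < s" "norm b < s"
    for a :: "complex^'a::finite" and b :: "complex^'b::finite"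
    using norm_join_le[of a b] that by (auto simp: s_def)
  show thesis
  proof
    show "s > 0" by fact
    show "join z w \<in> S" if "norm z < s" "norm w < s" for z w
      using r2(2)[OF small1(2)[OF that]] by blast
    fix z z' :: "complex^'n" and w :: "complex^'d"
    assume z: "norm z < s" "norm z' < s" and w: "norm w < s"
    define B where "B = ball (0 :: complex^('n+'d)) s"
    define D where "D v = f (\<pi> (join z v)) * g (\<pi> (join z' v)) - g (\<pi> (join z v)) * f (\<pi> (join z' v))" for v
    have inS': "join a v \<in> S'" "H (join a v) = 0" if "norm a < s" "v \<in> B" for a :: "complex^'n" and v
      using r1(2)[OF small1(1)[OF that(1), of v]] that(2) by (auto simp: B_def)
    have \<pi>B: "holomorphic_map_on (\<lambda>v. \<pi> (join a v)) B" if "norm a < s" for a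
    proof (rule holomorphic_map_on_compose[OF \<pi>S'])
      show "holomorphic_map_on (join a) B"
        by (intro holomorphic_map_on_join holomorphic_map_on_const holomorphic_map_on_linear) (auto simp: B_def)
    qed (use inS' that in auto)
    have \<pi>BS: "\<pi> (join a v) \<in> S" if "norm a < s" "v \<in> B" for a v
      using inS'(1)[OF that] by (simp add: S'_def)
    have Dhol: "mv_holomorphic_on D B"
      unfolding D_def
      by (intro mv_holomorphic_on_diff mv_holomorphic_on_mult
          mv_holomorphic_on_compose[OF hol(1) \<pi>B] mv_holomorphic_on_compose[OF hol(2) \<pi>B])
        (auto intro: z \<pi>BS)
    have BS: "v \<in> cnjv -` S" if "v \<in> B" for v
      using inS'(1)[OF s[folded norm_zero[where 'a="complex^'n"]] that] by (simp add: S'_def)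
    have cont: "continuous_on B (\<lambda>v. cnj (F (cnjv v)))" "continuous_on B (\<lambda>v. cnj (G (cnjv v)))"
      using hol(3,4)[THEN mv_holomorphic_on_cnj, THEN mv_holomorphic_on_imp_continuous_on] BS
      by (auto intro: continuous_on_subset)
    define N where "N = (B \<inter> (\<lambda>v. cnj (F (cnjv v))) -` (- {0})) \<union> (B \<inter> (\<lambda>v. cnj (G (cnjv v))) -` (- {0}))"
    have "open N" unfolding N_def
      by (intro open_Un continuous_open_preimage cont) (auto simp: B_def)
    have "\<forall>\<^sub>F p in nhds (0 :: complex^('n+'d)). p \<in> B"
      by (rule eventually_nhds_in_open) (use s in \<open>auto simp: B_def\<close>)
    from frequently_eventually_conj[OF nz this]
    obtain p where p: "p \<in> B" "F p \<noteq> 0 \<or> G p \<noteq> 0" by (auto dest: frequently_ex)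
    then have pN: "cnjv p \<in> N" by (auto simp: N_def B_def)
    have "D (join 0 w) = 0"
    proof (rule identity_theorem_convex[OF Dhol _ \<open>open N\<close> _ pN])
      show "convex B" "N \<subseteq> B" by (auto simp: B_def N_def)
      show "join 0 w \<in> B" using w by (simp add: B_def norm_join)
      fix v assume v: "v \<in> N"
      then have vB: "v \<in> B" by (auto simp: N_def)
      let ?F = "cnj (F (cnjv v))" and ?G = "cnj (G (cnjv v))"
      have 1: "f (\<pi> (join z v)) * ?F = g (\<pi> (join z v)) * ?G"
        and 2: "f (\<pi> (join z' v)) * ?F = g (\<pi> (join z' v)) * ?G"
        using inS'(2)[OF z(1) vB] inS'(2)[OF z(2) vB] by (simp_all add: H_def)
      have "D v * ?F = 0" "D v * ?G = 0"
        using 1 2 unfolding D_def by algebra+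
      then show "D v = 0" using v by (auto simp: N_def)
    qed
    moreover have "\<pi> (join a (join 0 w)) = join a w" if "norm a < s" for a
      using r2(2)[OF small1(2)[OF that w]] by (simp add: \<pi>_def)
    ultimately show "f (join z w) * g (join z' w) = g (join z w) * f (join z' w)"
      using z by (simp add: D_def)
  qed
qed

section \<open>From independence of z to a meromorphic function of w\<close>

text \<open>A generic slice \<open>z = z\<^sub>0\<close>, on which \<open>g\<close> does not vanish identically, gives the function
  \<open>k = \<Psi> / \<Phi>\<close> of \<open>w\<close> with \<open>\<Psi>(w) = f(z\<^sub>0, w)\<close> and \<open>\<Phi>(w) = g(z\<^sub>0, w)\<close>. A point where \<open>h\<close> is defined
  may still lie over a zero \<open>w\<close> of \<open>\<Phi>\<close>; there \<open>k\<close> takes the value of \<open>h\<close> at any such point over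
  \<open>w\<close>. This value does not depend on the point: by \<open>h \<Phi> = \<Psi>\<close>, the restrictions of \<open>h\<close> to the two
  slices agree off the zeros of \<open>\<Phi>\<close>, hence also at \<open>w\<close>.\<close>

lemma depends_only_on_w_quotient:
  fixes h f g :: "complex^('n::finite+'d::finite) \<Rightarrow> complex"
  assumes hol: "mv_holomorphic_on f S" "mv_holomorphic_on g S"
    and nz: "\<exists>\<^sub>F p in nhds 0. g p \<noteq> 0"
    and s: "s > 0" "\<And>z w. norm z < s \<Longrightarrow> norm w < s \<Longrightarrow> join z w \<in> S"
    and indep: "\<And>z z' w. norm z < s \<Longrightarrow> norm z' < s \<Longrightarrow> norm w < s \<Longrightarrow>
       f (join z w) * g (join z' w) = g (join z w) * f (join z' w)"
    and h: "\<And>p. p \<in> S \<Longrightarrow> g p \<noteq> 0 \<Longrightarrow> h p = f p / g p"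
  shows "depends_only_on_w h"
proof -
  define W where "W = {p :: complex^('n+'d). norm (zpart p) < s \<and> norm (wpart p) < s}"
  have "open W" unfolding W_def
    by (intro open_Collect_conj open_Collect_less continuous_intros)
  have "convex W"
  proof -
    have "W = zpart -` ball 0 s \<inter> wpart -` ball 0 s" by (auto simp: W_def)
    then show ?thesis
      by (auto intro!: convex_Int convex_linear_vimage bounded_linear.linear
          bounded_linear_zpart bounded_linear_wpart)
  qed
  have "0 \<in> W" using s by (simp add: W_def)
  have WS: "p \<in> S" if "p \<in> W" for p
    using s(2)[of "zpart p" "wpart p"] that by (simp add: W_def)
  have "\<exists>\<^sub>F p in nhds 0. p \<in> W \<and> g p \<noteq> 0"
    by (intro frequently_eventually_conj nz eventually_nhds_in_open \<open>open W\<close> \<open>0 \<in> W\<close>)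
  then obtain p0 where p0: "g p0 \<noteq> 0" "p0 \<in> W" by (auto dest: frequently_ex)
  define z0 where "z0 = zpart p0"
  have z0: "norm z0 < s" using p0 by (simp add: z0_def W_def)
  define V where "V = ball (0 :: complex^'d) s"
  define \<Phi> where "\<Phi> w = g (join z0 w)" for w
  define \<Psi> where "\<Psi> w = f (join z0 w)" for w
  have jhol: "holomorphic_map_on (join z0) V"
    by (intro holomorphic_map_on_join holomorphic_map_on_const holomorphic_map_on_linear) (auto simp: V_def)
  have \<Phi>: "mv_holomorphic_on \<Phi> V" and \<Psi>: "mv_holomorphic_on \<Psi> V"
    unfolding \<Phi>_def \<Psi>_def
    by (rule mv_holomorphic_on_compose[OF hol(1) jhol] mv_holomorphic_on_compose[OF hol(2) jhol],
        use s(2) z0 in \<open>simp add: V_def\<close>)+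
  have \<Phi>0: "\<Phi> (wpart p0) \<noteq> 0" "wpart p0 \<in> V"
    using p0 by (auto simp: \<Phi>_def z0_def V_def W_def)
  \<comment> \<open>The identity is clear where \<open>g \<noteq> 0\<close> and spreads to the ball, as \<open>g\<close> has no zero germ there.\<close>
  have key: "h q * \<Phi> (wpart q) = \<Psi> (wpart q)"
    if p: "mv_holomorphic_on h U" "p \<in> U" and e: "e > 0" "ball p e \<subseteq> U \<inter> W" and q: "q \<in> ball p e" for U p e q
  proof -
    have gW: "mv_holomorphic_on g W" using mv_holomorphic_on_subset[OF hol(2) \<open>open W\<close>] WS by blast
    have "p \<in> W" using e by auto
    have "\<exists>\<^sub>F x in nhds p. g x \<noteq> 0"
      using identity_theorem_frequently[OF gW convex_connected[OF \<open>convex W\<close>] \<open>p \<in> W\<close> p0(2,1)] .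
    then have "\<exists>\<^sub>F x in nhds p. x \<in> ball p e \<and> g x \<noteq> 0"
      by (intro frequently_eventually_conj eventually_nhds_in_open) (use e in auto)
    then obtain x where x: "g x \<noteq> 0" "x \<in> ball p e" by (auto dest: frequently_ex)
    define N where "N = ball p e \<inter> g -` (-{0})"
    have "continuous_on (ball p e) g"
      using mv_holomorphic_on_imp_continuous_on[OF gW] e by (auto intro: continuous_on_subset)
    then have oN: "open N" unfolding N_def
      by (intro continuous_open_preimage) auto
    have wmap: "holomorphic_map_on wpart (ball p e)" by (rule holomorphic_map_on_linear) auto
    have wV: "wpart y \<in> V" if "y \<in> ball p e" for y
      using e that by (auto simp: V_def W_def)
    have "h q * \<Phi> (wpart q) - \<Psi> (wpart q) = 0"
    proof (rule identity_theorem_convex[where B = "ball p e" and N = N and p = x and q = q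
          and f = "\<lambda>y. h y * \<Phi> (wpart y) - \<Psi> (wpart y)"])
      show "mv_holomorphic_on (\<lambda>y. h y * \<Phi> (wpart y) - \<Psi> (wpart y)) (ball p e)"
        by (intro mv_holomorphic_on_diff mv_holomorphic_on_mult mv_holomorphic_on_compose[OF \<Phi> wmap]
            mv_holomorphic_on_compose[OF \<Psi> wmap] wV mv_holomorphic_on_subset[OF p(1)])
          (use e in auto)
      fix y assume y: "y \<in> N"
      then have yW: "y \<in> W" using e by (auto simp: N_def)
      have "f y * \<Phi> (wpart y) = g y * \<Psi> (wpart y)"
        using indep[of "zpart y" z0 "wpart y"] yW z0 by (simp add: W_def \<Phi>_def \<Psi>_def)
      moreover have "h y * g y = f y" using h[OF WS[OF yW]] y by (simp add: N_def)
      ultimately have "g y * (h y * \<Phi> (wpart y) - \<Psi> (wpart y)) = 0" by algebra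
      then show "h y * \<Phi> (wpart y) - \<Psi> (wpart y) = 0" using y by (simp add: N_def)
    qed (use x q oN in \<open>auto simp: N_def\<close>)
    then show ?thesis by simp
  qed
  have nbhd: "\<exists>U e. mv_holomorphic_on h U \<and> p \<in> U \<and> e > 0 \<and> ball p e \<subseteq> U \<inter> W"
    if pW: "p \<in> W" and hp: "mv_holomorphic_at h p" for p
  proof -
    obtain U where U: "p \<in> U" "mv_holomorphic_on h U" using hp unfolding mv_holomorphic_at_def by blast
    then have "open (U \<inter> W)" "p \<in> U \<inter> W"
      using \<open>open W\<close> pW by (auto simp: mv_holomorphic_on_def)
    then show ?thesis using U open_contains_ball by metis
  qed
  have unique: "h p = h p'"
    if pW: "p \<in> W" "p' \<in> W" and hp: "mv_holomorphic_at h p" "mv_holomorphic_at h p'"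
      and w: "wpart p = wpart p'" for p p'
  proof -
    obtain U e where U: "mv_holomorphic_on h U" "p \<in> U" "e > 0" "ball p e \<subseteq> U \<inter> W" using nbhd pW hp by metis
    obtain U' e' where U': "mv_holomorphic_on h U'" "p' \<in> U'" "e' > 0" "ball p' e' \<subseteq> U' \<inter> W"
      using nbhd pW hp by metis
    define d where "d = min e e'"
    have d: "d > 0" using U U' by (simp add: d_def)
    define B where "B = ball (wpart p) d"
    define sec where "sec x v = join (zpart x) v" for x :: "complex^('n+'d)" and v :: "complex^'d"
    have nj: "dist x (sec x v) = dist (wpart x) v" for x v
    proof -
      have "x - sec x v = join 0 (wpart x - v)"
        by (simp add: sec_def parts_eq_iff) (auto simp: zpart_def wpart_def join_def vec_eq_iff)
      then show ?thesis by (simp add: dist_norm norm_join)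
    qed
    have inb: "sec p v \<in> ball p e" "sec p' v \<in> ball p' e'" if "v \<in> B" for v
      using that w by (auto simp: B_def nj d_def)
    have sechol: "holomorphic_map_on (sec x) B" for x
      unfolding sec_def
      by (intro holomorphic_map_on_join holomorphic_map_on_const holomorphic_map_on_linear) (auto simp: B_def)
    have BV: "B \<subseteq> V"
    proof
      fix v assume "v \<in> B"
      then have "sec p v \<in> W" using inb U by blast
      then show "v \<in> V" by (simp add: W_def V_def sec_def)
    qed
    have "wpart p \<in> V" using pW by (simp add: V_def W_def)
    have "\<exists>\<^sub>F x in nhds (wpart p). \<Phi> x \<noteq> 0"
      by (rule identity_theorem_frequently[OF \<Phi> _ \<open>wpart p \<in> V\<close> \<Phi>0(2,1)]) (simp add: V_def)
    then have "\<exists>\<^sub>F x in nhds (wpart p). x \<in> B \<and> \<Phi> x \<noteq> 0"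
      by (intro frequently_eventually_conj eventually_nhds_in_open) (use d in \<open>auto simp: B_def\<close>)
    then obtain v0 where v0: "\<Phi> v0 \<noteq> 0" "v0 \<in> B" by (auto dest: frequently_ex)
    define N where "N = B \<inter> \<Phi> -` (-{0})"
    have "open N" unfolding N_def
      using mv_holomorphic_on_imp_continuous_on[OF \<Phi>] BV
      by (intro continuous_open_preimage) (auto simp: B_def intro: continuous_on_subset)
    have "h (sec p (wpart p)) - h (sec p' (wpart p)) = 0"
    proof (rule identity_theorem_convex[where B = B and N = N and p = v0 and q = "wpart p"
          and f = "\<lambda>v. h (sec p v) - h (sec p' v)"])
      show "mv_holomorphic_on (\<lambda>v. h (sec p v) - h (sec p' v)) B"
        by (intro mv_holomorphic_on_diff mv_holomorphic_on_compose[OF U(1) sechol]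
            mv_holomorphic_on_compose[OF U'(1) sechol])
          (use inb U(4) U'(4) in auto)
      fix v assume v: "v \<in> N"
      then have "v \<in> B" "\<Phi> v \<noteq> 0" by (auto simp: N_def)
      have "h (sec p v) * \<Phi> v = \<Psi> v" "h (sec p' v) * \<Phi> v = \<Psi> v"
        using key[OF U inb(1)] key[OF U' inb(2)] \<open>v \<in> B\<close> by (auto simp: sec_def)
      then show "h (sec p v) - h (sec p' v) = 0" using \<open>\<Phi> v \<noteq> 0\<close> by (metis mult_right_cancel right_minus_eq)
    qed (use v0 \<open>open N\<close> d in \<open>auto simp: N_def B_def\<close>)
    then show ?thesis by (simp add: sec_def w) (metis join_parts w)
  qed
  define k where "k w = (if \<Phi> w \<noteq> 0 then \<Psi> w / \<Phi> w
     else h (SOME p. p \<in> W \<and> wpart p = w \<and> mv_holomorphic_at h p))" for w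
  have "mv_meromorphic_on k V"
    unfolding mv_meromorphic_on_def
  proof (intro conjI ballI)
    show "open V" by (simp add: V_def)
    fix p assume "p \<in> V"
    then show "\<exists>W f g. open W \<and> connected W \<and> p \<in> W \<and> W \<subseteq> V \<and>
        mv_holomorphic_on f W \<and> mv_holomorphic_on g W \<and> (\<exists>q\<in>W. g q \<noteq> 0) \<and>
        (\<forall>q\<in>W. g q \<noteq> 0 \<longrightarrow> k q = f q / g q)"
      using \<Phi> \<Psi> \<Phi>0 by (intro exI[of _ V] exI[of _ \<Psi>] exI[of _ \<Phi>]) (auto simp: V_def k_def)
  qed
  moreover have "h p = k (wpart p)" if hp: "p \<in> W" "mv_holomorphic_at h p" for p
  proof (cases "\<Phi> (wpart p) = 0")
    case False
    obtain U e where "mv_holomorphic_on h U" "p \<in> U" "e > 0" "ball p e \<subseteq> U \<inter> W" using nbhd[OF hp] by metis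
    then have "h p * \<Phi> (wpart p) = \<Psi> (wpart p)" using key[of U p e p] by simp
    then show ?thesis using False by (simp add: k_def field_simps)
  next
    case True
    let ?p = "SOME p'. p' \<in> W \<and> wpart p' = wpart p \<and> mv_holomorphic_at h p'"
    have "?p \<in> W \<and> wpart ?p = wpart p \<and> mv_holomorphic_at h ?p"
      by (rule someI[of _ p]) (use hp in simp)
    then show ?thesis using unique[of p ?p] hp True by (simp add: k_def)
  qed
  moreover have "wpart p \<in> V" if "p \<in> W" for p using that by (simp add: W_def V_def)
  ultimately show ?thesis
    unfolding depends_only_on_w_def
    using \<open>open W\<close> \<open>0 \<in> W\<close> s by (intro exI[of _ W] exI[of _ V] exI[of _ k]) (auto simp: V_def)
qed

section \<open>Quotients that are unimodular or real on M\<close>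

theorem theorem3p10:
  fixes M :: "(complex^('n::finite+'d::finite)) set"
    and Q :: "complex^'n \<Rightarrow> complex^'n \<Rightarrow> complex^'d \<Rightarrow> complex^'d"
  assumes "generic_submanifold CARD('d) CARD('n) M"
    and "0 \<in> M"
    and "normal_coordinates M Q"
  shows "(\<forall>U f g. open U \<and> connected U \<and> 0 \<in> U \<and>
             mv_holomorphic_on f U \<and> mv_holomorphic_on g U \<and> (\<exists>p\<in>U. g p \<noteq> 0) \<and>
             (\<forall>p\<in>M \<inter> U. cmod (f p) = cmod (g p)) \<longrightarrow>
             depends_only_on_w (\<lambda>p. f p / g p)) \<and>
         (\<forall>U h. 0 \<in> U \<and> mv_meromorphic_on h U \<and>
             (\<forall>p\<in>M \<inter> U. mv_holomorphic_at h p \<longrightarrow> h p \<in> \<real>) \<longrightarrow>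
             depends_only_on_w h)"
proof (intro conjI allI impI; elim conjE bexE)
  fix U and f g :: "complex^('n+'d) \<Rightarrow> complex" and p
  assume *: "connected U" "0 \<in> U" "mv_holomorphic_on f U" "mv_holomorphic_on g U"
    "p \<in> U" "g p \<noteq> 0" "\<forall>p\<in>M \<inter> U. cmod (f p) = cmod (g p)"
  have nz: "\<exists>\<^sub>F p in nhds 0. g p \<noteq> 0"
    using identity_theorem_frequently[OF *(4,1,2,5,6)] .
  \<comment> \<open>The hypothesis \<open>|f| = |g|\<close> in the form that can be complexified.\<close>
  have eq: "f p * cnj (f p) = g p * cnj (g p)" if "p \<in> M \<inter> U" for p
    using *(7) that by (simp flip: complex_norm_square)
  obtain s where s: "s > 0" "\<And>z w. norm z < s \<Longrightarrow> norm w < s \<Longrightarrow> join z w \<in> U"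
    "\<And>z z' w. norm z < s \<Longrightarrow> norm z' < s \<Longrightarrow> norm w < s \<Longrightarrow>
       f (join z w) * g (join z' w) = g (join z w) * f (join z' w)"
    using quotient_independent_of_z[OF assms(3) *(3,4,3,4,2) eq frequently_mono[OF _ nz]] by blast
  show "depends_only_on_w (\<lambda>p. f p / g p)"
    by (rule depends_only_on_w_quotient[OF *(3,4) nz s]) auto
next
  fix U and h :: "complex^('n+'d) \<Rightarrow> complex"
  assume *: "0 \<in> U" "mv_meromorphic_on h U" "\<forall>p\<in>M \<inter> U. mv_holomorphic_at h p \<longrightarrow> h p \<in> \<real>"
  then obtain W f g p where W: "open W" "connected W" "0 \<in> W" "W \<subseteq> U"
    "mv_holomorphic_on f W" "mv_holomorphic_on g W" "p \<in> W" "g p \<noteq> 0"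
    and hfg: "\<And>q. q \<in> W \<Longrightarrow> g q \<noteq> 0 \<Longrightarrow> h q = f q / g q"
    unfolding mv_meromorphic_on_def by metis
  have nz: "\<exists>\<^sub>F p in nhds 0. g p \<noteq> 0"
    using identity_theorem_frequently[OF W(6,2,3,7,8)] .
  \<comment> \<open>Reality of \<open>f / g\<close>, cleared of denominators so that it also holds at zeros of \<open>g\<close>.\<close>
  have eq: "f p * cnj (g p) = g p * cnj (f p)" if "p \<in> M \<inter> W" for p
  proof (cases "g p = 0")
    case False
    define N where "N = W \<inter> g -` (-{0})"
    have "open N" unfolding N_def
      using mv_holomorphic_on_imp_continuous_on[OF W(6)] W(1) by (intro continuous_open_preimage) auto
    have "mv_holomorphic_on (\<lambda>q. f q / g q) N"
      by (intro mv_holomorphic_on_divide mv_holomorphic_on_subset[OF W(5)] mv_holomorphic_on_subset[OF W(6)] \<open>open N\<close>)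
        (auto simp: N_def)
    then have "mv_holomorphic_on h N"
      by (rule mv_holomorphic_on_transform) (auto simp: N_def hfg)
    moreover have "p \<in> N" using False that by (auto simp: N_def)
    ultimately have "mv_holomorphic_at h p" unfolding mv_holomorphic_at_def by blast
    then have "f p / g p \<in> \<real>" using *(3) W(4) that hfg False by auto
    then have "cnj (f p / g p) = f p / g p" by (simp add: Reals_cnj_iff)
    then show ?thesis using False by (simp add: field_simps)
  qed simp
  obtain s where s: "s > 0" "\<And>z w. norm z < s \<Longrightarrow> norm w < s \<Longrightarrow> join z w \<in> W"
    "\<And>z z' w. norm z < s \<Longrightarrow> norm z' < s \<Longrightarrow> norm w < s \<Longrightarrow>
       f (join z w) * g (join z' w) = g (join z w) * f (join z' w)"
    using quotient_independent_of_z[OF assms(3) W(5,6,6,5,3) eq frequently_mono[OF _ nz]] by blast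
  show "depends_only_on_w h"
    by (rule depends_only_on_w_quotient[OF W(5,6) nz s hfg]) auto
qed

end
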